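(* Let $q$ be a prime power and let $\mathcal S_1$ be the set of planes of ${\rm PG}(5,q)$ defined in the context below (built from the circumscribed bundle). Then $\mathcal S_1$ contains $q^3-q^2-q$ subsets each consisting of $q^3-1$ pairwise disjoint planes.
   Context: Work in ${\rm PG}(3,q)$ with points $\langle(x_1,x_2,x_3,x_4)\rangle$ (column vectors) and let $\pi$ be the plane $x_4=0$, identified with ${\rm PG}(2,q)$. Let $\sigma\in{\rm GL}(3,q)$ be a Singer cycle (an element of order $q^3-1$) and let $C_1$ be the cyclic group of collineations of $\pi$ induced by $\langle\sigma\rangle$; it has order $q^2+q+1$ and acts regularly on the points of $\pi$. Embedding $\pi$ in ${\rm PG}(2,q^3)$, $C_1$ fixes a unique triangle $\Delta$ whose three vertices lie in ${\rm PG}(2,q^3)\setminus{\rm PG}(2,q)$. The circumscribed bundle $\mathcal B$ is the set of non-degenerate conics of $\pi$ whose extensions over ${\rm GF}(q^3)$ contain the three vertices of $\Delta$; it consists of $q^2+q+1$ conics, any two meeting in exactly one point. Let $\mathcal H$ be the set of hyperbolic quadrics of ${\rm PG}(3,q)$ meeting $\pi$ in a conic of $\mathcal B$. Let $\rho$ be the Klein correspondence from the lines of ${\rm PG}(3,q)$ to the points of the Klein quadric $\mathcal K$ of ${\rm PG}(5,q)$. For a regulus $\mathcal R$ (one of the two families of $q+1$ lines on a hyperbolic quadric of ${\rm PG}(3,q)$), $\rho(\mathcal R)$ is a conic of $\mathcal K$ spanning a plane. $\mathcal S_1$ is the set of planes of ${\rm PG}(5,q)$ spanned by $\rho(\mathcal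 R)$ where $\mathcal R$ ranges over the reguli contained in the quadrics of $\mathcal H$; it has $q^6-q^3$ elements. *)

theory Defs
  imports "HOL-Analysis.Analysis"
begin

definition lspan :: "('a::field ^ 'n) set \<Rightarrow> ('a ^ 'n) set" where
  "lspan S = {v. \<exists>F c. finite F \<and> F \<subseteq> S \<and> v = (\<Sum>u\<in>F. c u *s u)}"

definition mapv :: "('a \<Rightarrow> 'b) \<Rightarrow> 'a ^ 'n \<Rightarrow> 'b ^ 'n" where
  "mapv f v = (\<chi> i. f (v $ i))"

definition mapm :: "('a \<Rightarrow> 'b) \<Rightarrow> 'a ^ 'n ^ 'm \<Rightarrow> 'b ^ 'n ^ 'm" where
  "mapm f A = (\<chi> i j. f (A $ i $ j))"

primrec mpow :: "'a::semiring_1 ^ 'n ^ 'n \<Rightarrow> nat \<Rightarrow> 'a ^ 'n ^ 'n" where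
  "mpow A 0 = mat 1"
| "mpow A (Suc k) = A ** mpow A k"

definition singer_cycle :: "'a::{field,finite} ^ 3 ^ 3 \<Rightarrow> bool" where
  "singer_cycle s \<longleftrightarrow>
     mpow s (CARD('a)^3 - 1) = mat 1 \<and>
     (\<forall>k. 0 < k \<and> k < CARD('a)^3 - 1 \<longrightarrow> mpow s k \<noteq> mat 1)"

definition field_ext3 :: "('a::{field,finite} \<Rightarrow> 'b::{field,finite}) \<Rightarrow> bool" where
  "field_ext3 emb \<longleftrightarrow>
     inj emb \<and> emb 0 = 0 \<and> emb 1 = 1 \<and>
     (\<forall>x y. emb (x + y) = emb x + emb y) \<and> (\<forall>x y. emb (x * y) = emb x * emb y) \<and>
     CARD('b) = CARD('a)^3"

text \<open>The quadratic form with coefficient matrix M: Q(x) = sum_{i,j} M_ij x_i x_j.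
  Every quadratic form arises this way (over any field).\<close>
definition qform :: "'a::comm_ring_1 ^ 'n ^ 'n \<Rightarrow> 'a ^ 'n \<Rightarrow> 'a" where
  "qform M x = (\<Sum>i\<in>UNIV. \<Sum>j\<in>UNIV. M $ i $ j * x $ i * x $ j)"

text \<open>Non-degenerate (non-singular) quadratic form: no non-zero singular vector,
  i.e. no non-zero x with Q(x)=0 lying in the radical of the polar form.\<close>
definition nondeg :: "'a::field ^ 'n ^ 'n \<Rightarrow> bool" where
  "nondeg M \<longleftrightarrow> \<not> (\<exists>x. x \<noteq> 0 \<and> qform M x = 0 \<and>
                     (\<forall>y. qform M (x + y) - qform M x - qform M y = 0))"

text \<open>Lines of PG(n-1,q): 2-dimensional subspaces.\<close>
definition is_line :: "('a::field ^ 'n) set \<Rightarrow> bool" where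
  "is_line L \<longleftrightarrow> (\<exists>u v. (\<forall>a b. a *s u + b *s v = 0 \<longrightarrow> a = 0 \<and> b = 0) \<and> L = lspan {u, v})"

definition qlines :: "'a::field ^ 'n ^ 'n \<Rightarrow> ('a ^ 'n) set set" where
  "qlines M = {L. is_line L \<and> (\<forall>x\<in>L. qform M x = 0)}"

definition hyperbolic :: "'a::field ^ 4 ^ 4 \<Rightarrow> bool" where
  "hyperbolic M \<longleftrightarrow> nondeg M \<and> qlines M \<noteq> {}"

definition regulus_of :: "'a::field ^ 'n ^ 'n \<Rightarrow> ('a ^ 'n) set \<Rightarrow> ('a ^ 'n) set set" where
  "regulus_of M L = {L' \<in> qlines M. L' = L \<or> L' \<inter> L = {0}}"

definition reguli :: "'a::field ^ 'n ^ 'n \<Rightarrow> ('a ^ 'n) set set set" where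
  "reguli M = {regulus_of M L | L. L \<in> qlines M}"

text \<open>Coordinates x1,x2,x3 of the plane pi (x4=0) sit at the first three indices.\<close>
definition idx3 :: "3 \<Rightarrow> 4" where
  "idx3 i = (if i = 0 then 0 else if i = 1 then 1 else 2)"

definition restr_pi :: "'a ^ 4 ^ 4 \<Rightarrow> 'a ^ 3 ^ 3" where
  "restr_pi M = (\<chi> i j. M $ idx3 i $ idx3 j)"

text \<open>Vertices of the triangle Delta: points of PG(2,q^3) \ PG(2,q) fixed by sigma
  (represented by non-zero vectors).\<close>
definition delta_vertices ::
  "('a::{field,finite} \<Rightarrow> 'b::{field,finite}) \<Rightarrow> 'a ^ 3 ^ 3 \<Rightarrow> ('b ^ 3) set" where
  "delta_vertices emb s = {v. v \<noteq> 0 \<and> (\<exists>l. mapm emb s *v v = l *s v) \<and>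
                              \<not> (\<exists>c w. v = c *s mapv emb w)}"

text \<open>Circumscribed bundle: non-degenerate conics of pi whose extension over
  GF(q^3) passes through the vertices of Delta (conics given by their forms).\<close>
definition circ_bundle ::
  "('a::{field,finite} \<Rightarrow> 'b::{field,finite}) \<Rightarrow> 'a ^ 3 ^ 3 \<Rightarrow> ('a ^ 3 ^ 3) set" where
  "circ_bundle emb s = {A. nondeg A \<and> (\<forall>v\<in>delta_vertices emb s. qform (mapm emb A) v = 0)}"

definition hyp_set ::
  "('a::{field,finite} \<Rightarrow> 'b::{field,finite}) \<Rightarrow> 'a ^ 3 ^ 3 \<Rightarrow> ('a ^ 4 ^ 4) set" where
  "hyp_set emb s = {M. hyperbolic M \<and> restr_pi M \<in> circ_bundle emb s}"

definition pl_i :: "6 \<Rightarrow> 4" where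
  "pl_i k = (if k = 0 then 0 else if k = 1 then 0 else if k = 2 then 0
             else if k = 3 then 1 else if k = 4 then 1 else 2)"

definition pl_j :: "6 \<Rightarrow> 4" where
  "pl_j k = (if k = 0 then 1 else if k = 1 then 2 else if k = 2 then 3
             else if k = 3 then 2 else if k = 4 then 3 else 3)"

definition plucker :: "'a::comm_ring_1 ^ 4 \<Rightarrow> 'a ^ 4 \<Rightarrow> 'a ^ 6" where
  "plucker u v = (\<chi> k. u $ pl_i k * v $ pl_j k - u $ pl_j k * v $ pl_i k)"

text \<open>rho(L) as a 1-dimensional subspace of GF(q)^6 (a point of PG(5,q)).\<close>
definition klein :: "('a::field ^ 4) set \<Rightarrow> ('a ^ 6) set" where
  "klein L = lspan {plucker u v | u v. u \<in> L \<and> v \<in> L}"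

definition klein_span :: "('a::field ^ 4) set set \<Rightarrow> ('a ^ 6) set" where
  "klein_span R = lspan (\<Union>L\<in>R. klein L)"

text \<open>The set S_1 of planes of PG(5,q) (as 3-dim subspaces of GF(q)^6).\<close>
definition S1 ::
  "('a::{field,finite} \<Rightarrow> 'b::{field,finite}) \<Rightarrow> 'a ^ 3 ^ 3 \<Rightarrow> ('a ^ 6) set set" where
  "S1 emb s = {klein_span R | R M. M \<in> hyp_set emb s \<and> R \<in> reguli M}"

end

theory Submission
  imports Defs
begin

text \<open>A plane of \<open>PG(5,q)\<close> disjoint from the plane \<open>\<rho>(\<pi>)\<close> of lines of \<open>\<pi>\<close> is the graph of a
  \<open>3 \<times> 3\<close> matrix \<open>A\<close>: the line through \<open>(x, 0)\<close> and \<open>(y, 1)\<close> has Pluecker coordinates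
  \<open>(x \<times> y, x)\<close>, so its image lies in the graph iff \<open>x \<times> y = A x\<close>. If \<open>x\<^sup>T A x\<close> is a nondegenerate conic, these lines
  form a regulus of the quadric whose affine points are given by \<open>det (A + [y]) = 0\<close>, where
  \<open>[y] x = y \<times> x\<close>, and this quadric meets \<open>\<pi>\<close> in the conic \<open>x\<^sup>T A x = 0\<close>. Thus \<open>S\<^sub>1\<close> contains the graph of every
  matrix \<open>A\<close> whose conic is in the circumscribed bundle.

  Identify \<open>\<pi>\<close> with \<open>GF(q\<^sup>3)\<close> so that the Singer cycle becomes multiplication by \<open>l\<close>. The forms of the
  bundle are \<open>Tr (b X\<^sup>q\<^sup>+\<^sup>1)\<close> with \<open>b \<noteq> 0\<close>. Let \<open>A\<^sub>b\<close> be the matrix of the bilinear form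
  \<open>Tr (b X Y\<^sup>q)\<close>. It is invertible for \<open>b \<noteq> 0\<close> and additive in \<open>b\<close>, so for a fixed alternating
  matrix \<open>[t]\<close> the graphs of the \<open>q\<^sup>3 - 1\<close> matrices \<open>A\<^sub>b + [t]\<close>, \<open>b \<noteq> 0\<close>, are pairwise disjoint. The
  \<open>q\<^sup>3\<close> choices of \<open>t\<close> give different sets.\<close>

section \<open>Vectors, cross products and quadratic forms in dimension 3\<close>

lemma three_zero: "(3::3) = 0" and four_zero: "(4::4) = 0"
  by simp_all

lemma all_3: "(\<forall>i::3. P i) \<longleftrightarrow> P 0 \<and> P 1 \<and> P 2"
  unfolding forall_3 three_zero by auto

lemma all_4: "(\<forall>i::4. P i) \<longleftrightarrow> P 0 \<and> P 1 \<and> P 2 \<and> P 3"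
  unfolding forall_4 four_zero by auto

lemma sum_UNIV_3: "sum f (UNIV :: 3 set) = f 0 + f 1 + f 2"
  by (simp add: sum_3 three_zero add_ac)

lemma sum_UNIV_4: "sum f (UNIV :: 4 set) = f 0 + f 1 + f 2 + f 3"
  by (simp add: sum_4 four_zero add_ac)

lemma all_6: "(\<forall>k::6. P k) \<longleftrightarrow> P 0 \<and> P 1 \<and> P 2 \<and> P 3 \<and> P 4 \<and> P 5"
proof (intro iffI allI)
  fix k :: 6
  assume P: "P 0 \<and> P 1 \<and> P 2 \<and> P 3 \<and> P 4 \<and> P 5"
  show "P k"
  proof (induct k)
    case (of_int z)
    then have "z = 0 \<or> z = 1 \<or> z = 2 \<or> z = 3 \<or> z = 4 \<or> z = 5" by fastforce
    with P show ?case by auto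
  qed
qed auto

lemma vec3_eq_iff: "x = y \<longleftrightarrow> x $ 0 = y $ 0 \<and> x $ 1 = y $ 1 \<and> x $ 2 = (y :: 'a ^ 3) $ 2"
  by (simp add: vec_eq_iff all_3)

lemma vec4_eq_iff:
  "x = y \<longleftrightarrow> x $ 0 = y $ 0 \<and> x $ 1 = y $ 1 \<and> x $ 2 = y $ 2 \<and> x $ 3 = (y :: 'a ^ 4) $ 3"
  by (simp add: vec_eq_iff all_4)

definition dot :: "'a::comm_ring_1 ^ 'n \<Rightarrow> 'a ^ 'n \<Rightarrow> 'a" where
  "dot x y = (\<Sum>i\<in>UNIV. x $ i * y $ i)"

definition cross :: "'a::comm_ring_1 ^ 3 \<Rightarrow> 'a ^ 3 \<Rightarrow> 'a ^ 3" where
  "cross x y = (\<chi> i. if i = 0 then x $ 1 * y $ 2 - x $ 2 * y $ 1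
                else if i = 1 then x $ 2 * y $ 0 - x $ 0 * y $ 2
                else x $ 0 * y $ 1 - x $ 1 * y $ 0)"

definition crossm :: "'a::comm_ring_1 ^ 3 \<Rightarrow> 'a ^ 3 ^ 3" where
  "crossm w = (\<chi> i j. cross w (axis j 1) $ i)"

lemma dot_3: "dot x y = x $ 0 * y $ 0 + x $ 1 * y $ 1 + x $ 2 * (y :: 'a::comm_ring_1 ^ 3) $ 2"
  by (simp add: dot_def sum_UNIV_3)

lemma cross_nth [simp]:
  "cross x y $ 0 = x $ 1 * y $ 2 - x $ 2 * y $ 1"
  "cross x y $ 1 = x $ 2 * y $ 0 - x $ 0 * y $ 2"
  "cross x y $ 2 = x $ 0 * y $ 1 - x $ 1 * y $ 0"
  by (simp_all add: cross_def)

lemma crossm_mult [simp]: "crossm w *v x = cross w x"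
  by (simp add: vec3_eq_iff crossm_def matrix_vector_mult_def sum_UNIV_3 axis_def algebra_simps)

lemma crossm_nth:
  "crossm w $ 0 $ 0 = 0" "crossm w $ 0 $ 1 = - w $ 2" "crossm w $ 0 $ 2 = w $ 1"
  "crossm w $ 1 $ 0 = w $ 2" "crossm w $ 1 $ 1 = 0" "crossm w $ 1 $ 2 = - w $ 0"
  "crossm w $ 2 $ 0 = - w $ 1" "crossm w $ 2 $ 1 = w $ 0" "crossm w $ 2 $ 2 = 0"
  by (simp_all add: crossm_def axis_def)

lemma crossm_add: "crossm (v + w) = crossm v + crossm w"
  by (simp add: vec3_eq_iff crossm_nth)

lemma crossm_eq_iff: "crossm v = crossm w \<longleftrightarrow> v = w"
  by (auto simp: vec3_eq_iff crossm_nth)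

lemma dot_commute: "dot x y = dot y x"
  by (simp add: dot_def mult.commute)

lemma dot_add_left: "dot (x + y) z = dot x z + dot y z"
  and dot_add_right: "dot x (y + z) = dot x y + dot x z"
  and dot_smult_left: "dot (c *s x) z = c * dot x z"
  and dot_smult_right: "dot x (c *s z) = c * dot x z"
  by (simp_all add: dot_def algebra_simps sum.distrib sum_distrib_left)

lemma dot_zero [simp]: "dot 0 x = 0" "dot x 0 = 0"
  by (simp_all add: dot_def)

lemmas dot_linear = dot_add_left dot_add_right dot_smult_left dot_smult_right

lemma dot_transpose: "dot x (A *v y) = dot (transpose A *v x) y"
proof -
  have "dot x (A *v y) = (\<Sum>i\<in>UNIV. \<Sum>j\<in>UNIV. A $ i $ j * x $ i * y $ j)"
    by (simp add: dot_def matrix_vector_mult_def sum_distrib_left mult_ac)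
  also have "\<dots> = (\<Sum>j\<in>UNIV. \<Sum>i\<in>UNIV. A $ i $ j * x $ i * y $ j)"
    by (rule sum.swap)
  also have "\<dots> = dot (transpose A *v x) y"
    by (simp add: dot_def matrix_vector_mult_def transpose_def sum_distrib_right)
  finally show ?thesis .
qed

lemma dot_all_zero: "(\<forall>y. dot x y = 0) \<longleftrightarrow> x = 0"
proof
  assume *: "\<forall>y. dot x y = 0"
  show "x = 0"
  proof (rule vec_eq_iff[THEN iffD2], rule allI)
    fix i
    have "dot x (axis i 1) = x $ i"
      by (simp add: dot_def axis_def if_distrib sum.delta cong: if_cong)
    then show "x $ i = 0 $ i" using * by simp
  qed
qed simp

lemma cross_self [simp]: "cross x x = 0"
  and cross_zero [simp]: "cross 0 x = 0" "cross x 0 = 0"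
  and cross_commute: "cross x y = - cross y x"
  and cross_add_left: "cross (x + z) y = cross x y + cross z y"
  and cross_add_right: "cross y (x + z) = cross y x + cross y z"
  and cross_smult_left: "cross (c *s x) y = c *s cross x y"
  and cross_smult_right: "cross y (c *s x) = c *s cross y x"
  by (simp_all add: vec3_eq_iff algebra_simps)

lemma dot_cross [simp]: "dot x (cross x y) = 0" "dot y (cross x y) = 0"
  "dot (cross x y) x = 0" "dot (cross x y) y = 0"
  by (simp_all add: dot_3 algebra_simps)

lemma cross_cross: "cross g (cross x y) = dot g y *s x - dot g x *s y"
  by (simp add: vec3_eq_iff dot_3 algebra_simps)

lemma cross_eq_0_imp:
  fixes u v :: "'a::field ^ 3"
  assumes "cross u v = 0" "v \<noteq> 0"
  shows "\<exists>a. u = a *s v"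
proof -
  have e: "u $ 1 * v $ 2 = u $ 2 * v $ 1" "u $ 2 * v $ 0 = u $ 0 * v $ 2" "u $ 0 * v $ 1 = u $ 1 * v $ 0"
    using assms(1) by (simp_all add: vec3_eq_iff)
  consider "v $ 0 \<noteq> 0" | "v $ 1 \<noteq> 0" | "v $ 2 \<noteq> 0"
    using assms(2) by (auto simp: vec3_eq_iff)
  then show ?thesis
  proof cases
    case 1
    then show ?thesis using e
      by (intro exI[of _ "u $ 0 / v $ 0"]) (simp add: vec3_eq_iff field_simps)
  next
    case 2
    then show ?thesis using e
      by (intro exI[of _ "u $ 1 / v $ 1"]) (simp add: vec3_eq_iff field_simps)
  next
    case 3
    then show ?thesis using e
      by (intro exI[of _ "u $ 2 / v $ 2"]) (simp add: vec3_eq_iff field_simps)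
  qed
qed

text \<open>The vector \<open>y\<close> is only determined modulo \<open>x\<close>, so its
  coordinate at a place where \<open>x\<close> is nonzero can be set to 0 and the other two solved
  for.\<close>

lemma orthogonal_imp_cross:
  fixes x p :: "'a::field ^ 3"
  assumes "x \<noteq> 0" "dot x p = 0"
  shows "\<exists>y. p = cross x y"
proof -
  define v3 :: "'a \<Rightarrow> 'a \<Rightarrow> 'a \<Rightarrow> 'a ^ 3"
    where "v3 a b c = (\<chi> i. if i = 0 then a else if i = 1 then b else c)" for a b c
  have v3 [simp]: "v3 a b c $ 0 = a" "v3 a b c $ 1 = b" "v3 a b c $ 2 = c" for a b c
    by (simp_all add: v3_def)
  have d: "x $ 0 * p $ 0 + x $ 1 * p $ 1 + x $ 2 * p $ 2 = 0"
    using assms(2) by (simp add: dot_3)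
  consider "x $ 0 \<noteq> 0" | "x $ 1 \<noteq> 0" | "x $ 2 \<noteq> 0"
    using assms(1) by (auto simp: vec3_eq_iff)
  then show ?thesis
  proof cases
    case 1
    show ?thesis using 1 d
      by (intro exI[of _ "v3 0 (p $ 2 / x $ 0) (- p $ 1 / x $ 0)"])
        (simp add: vec3_eq_iff field_simps, algebra)
  next
    case 2
    show ?thesis using 2 d
      by (intro exI[of _ "v3 (- p $ 2 / x $ 1) 0 (p $ 0 / x $ 1)"])
        (simp add: vec3_eq_iff field_simps, algebra)
  next
    case 3
    show ?thesis using 3 d
      by (intro exI[of _ "v3 (p $ 1 / x $ 2) (- p $ 0 / x $ 2) 0"])
        (simp add: vec3_eq_iff field_simps, algebra)
  qed
qed

text \<open>If \<open>cross y z\<close> is nonzero, then \<open>x\<close> is orthogonal to it, hence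
  a cross product with it, and the triple product expansion writes \<open>x\<close> in terms of
  \<open>y\<close> and \<open>z\<close>.\<close>

lemma coplanar_dependent:
  fixes x y z :: "'a::field ^ 3"
  assumes "dot x (cross y z) = 0"
  shows "\<exists>a b c. (a \<noteq> 0 \<or> b \<noteq> 0 \<or> c \<noteq> 0) \<and> a *s x + b *s y + c *s z = 0"
proof (cases "cross y z = 0")
  case True
  show ?thesis
  proof (cases "z = 0")
    case True
    then show ?thesis by (intro exI[of _ 0] exI[of _ 1]) auto
  next
    case False
    then obtain a where "y = a *s z"
      using cross_eq_0_imp True by blast
    then have "0 *s x + 1 *s y + (- a) *s z = 0" by (simp add: vec_eq_iff)
    then show ?thesis by (metis zero_neq_one)
  qed
next
  case False
  then have yz: "y \<noteq> 0" "z \<noteq> 0" by auto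
  define g where "g = cross y z"
  obtain w where w: "x = cross g w"
    using orthogonal_imp_cross[of g x] False assms by (auto simp: dot_commute g_def)
  have "x = dot w y *s z - dot w z *s y"
    unfolding w g_def by (simp add: vec3_eq_iff dot_3 algebra_simps)
  then have "1 *s x + dot w z *s y + (- dot w y) *s z = 0"
    by (simp add: vec_eq_iff)
  then show ?thesis by (metis zero_neq_one)
qed

lemma det_UNIV_3: "det (A :: 'a::comm_ring_1 ^ 3 ^ 3) =
    A $ 0 $ 0 * A $ 1 $ 1 * A $ 2 $ 2 + A $ 0 $ 1 * A $ 1 $ 2 * A $ 2 $ 0 + A $ 0 $ 2 * A $ 1 $ 0 * A $ 2 $ 1
  - A $ 0 $ 0 * A $ 1 $ 2 * A $ 2 $ 1 - A $ 0 $ 1 * A $ 1 $ 0 * A $ 2 $ 2 - A $ 0 $ 2 * A $ 1 $ 1 * A $ 2 $ 0"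
  unfolding det_3 three_zero by (simp add: algebra_simps)

lemma det_eq_0_iff_kernel:
  fixes A :: "'a::field ^ 'n ^ 'n"
  shows "det A = 0 \<longleftrightarrow> (\<exists>x. x \<noteq> 0 \<and> A *v x = 0)"
  using invertible_det_nz[of A] matrix_left_invertible_ker[of A]
  by (auto simp: invertible_left_inverse)

section \<open>Quadratic forms, polar vectors and conics\<close>

lemma qform_dot: "qform A x = dot x (A *v x)"
  by (simp add: qform_def dot_def matrix_vector_mult_def sum_distrib_left mult_ac)

lemma qform_zero [simp]: "qform A 0 = 0"
  by (simp add: qform_dot)

lemma qform_smult: "qform A (c *s x :: 'a::field ^ 'n) = c ^ 2 * qform A x"
  by (simp add: qform_dot dot_linear vec.scale power2_eq_square)

text \<open>The vector that represents the polar form at \<open>x\<close>, so that lying in the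
  radical becomes a vector equation.\<close>

definition polar :: "'a::comm_ring_1 ^ 'n ^ 'n \<Rightarrow> 'a ^ 'n \<Rightarrow> 'a ^ 'n" where
  "polar A x = A *v x + transpose A *v x"

lemma qform_add: "qform A (x + y) = qform A x + qform A y + dot (polar A x) y"
proof -
  have "qform A (x + y) = qform A x + qform A y + (dot x (A *v y) + dot y (A *v x))"
    by (simp add: qform_dot dot_linear matrix_vector_right_distrib)
  also have "dot x (A *v y) + dot y (A *v x) = dot (polar A x) y"
    by (simp only: dot_transpose[of x] polar_def dot_add_left) (simp add: dot_commute)
  finally show ?thesis .
qed

lemma nondeg_iff: "nondeg A \<longleftrightarrow> (\<forall>x. qform A x = 0 \<and> polar A x = 0 \<longrightarrow> x = 0)"
  by (auto simp: nondeg_def qform_add simp flip: dot_all_zero)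

lemma polar_linear: "polar A (x + y) = polar A x + polar A y" 
   "polar A (c *s x) = c *s polar A (x :: 'a::field ^ 'n)"
  by (simp_all add: polar_def matrix_vector_right_distrib vec.scale vec.scale_right_distrib)

lemma dot_polar_commute: "dot (polar A x) y = dot (polar A y) x"
  using qform_add[of A x y] qform_add[of A y x] by (simp add: add.commute)

text \<open>The polar vectors of \<open>x\<close> and \<open>y\<close> are both orthogonal to
  \<open>x\<close> and \<open>y\<close>. If \<open>cross x y\<close> were nonzero, both would be
  multiples of it, and a combination of \<open>x\<close> and \<open>y\<close> would be a singular
  vector. The argument is valid in every characteristic.\<close>

lemma nondeg_no_line:
  fixes A :: "'a::field ^ 3 ^ 3"
  assumes "nondeg A" "qform A x = 0" "qform A y = 0" "dot (polar A x) y = 0"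
  shows "cross x y = 0"
proof (rule ccontr)
  assume n: "cross x y \<noteq> 0"
  have nd: "z = 0" if "qform A z = 0" "polar A z = 0" for z
    using assms(1) that unfolding nondeg_iff by blast
  have self: "dot (polar A z) z = 0" if "qform A z = 0" for z
  proof -
    have "z + z = 2 *s z" by (simp add: vec_eq_iff)
    then have "qform A (z + z) = 0" using that by (simp only: qform_smult) simp
    with that show ?thesis by (simp only: qform_add) simp
  qed
  have yx: "dot (polar A y) x = 0"
    using assms(4) by (simp add: dot_polar_commute[of A y])
  have "\<exists>a. polar A z = a *s cross x y" if "dot (polar A z) x = 0" "dot (polar A z) y = 0" for z
    using that n by (intro cross_eq_0_imp) (auto simp: cross_cross)
  then obtain a b where a: "polar A x = a *s cross x y" and b: "polar A y = b *s cross x y"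
    using self assms yx by metis
  have "x \<noteq> 0" using n by auto
  then have "a \<noteq> 0" using nd[of x] assms(2) a by auto
  \<comment> \<open>The coefficients make the two polar vectors cancel.\<close>
  define v where "v = b *s x + (- a) *s y"
  have "polar A v = 0"
    by (simp only: v_def polar_linear a b) (simp add: vec_eq_iff)
  moreover have "qform A v = 0"
    by (simp only: v_def qform_add qform_smult polar_linear dot_linear) (simp add: assms)
  ultimately have "b *s x + (- a) *s y = 0" using nd v_def by blast
  then have "cross x (b *s x + (- a) *s y) = 0" by simp
  then have "a *s cross x y = 0"
    by (simp only: cross_add_right cross_smult_right cross_self) (simp add: vec_eq_iff)
  with n \<open>a \<noteq> 0\<close> show False by simp
qed

text \<open>A line through \<open>x0\<close> other than the tangent meets the conic in a second
  zero, so every \<open>y\<close> off the tangent is in the span. A vector on the tangent is a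
  difference of two vectors off it.\<close>

lemma isotropic_span:
  fixes A :: "'a::field ^ 3 ^ 3"
  assumes "nondeg A" "x0 \<noteq> 0" "qform A x0 = 0"
  shows "vec.span {x. qform A x = 0} = UNIV"
proof -
  let ?S = "vec.span {x. qform A x = 0}"
  have off: "y \<in> ?S" if y: "dot (polar A x0) y \<noteq> 0" for y
  proof -
    define c where "c = qform A y / dot (polar A x0) y"
    have "qform A (y + (- c) *s x0) = 0"
      using y assms(3) dot_polar_commute[of A y x0]
      by (simp only: qform_add qform_smult dot_linear) (simp add: c_def)
    then have "y + (- c) *s x0 \<in> ?S" "x0 \<in> ?S"
      using assms(3) by (auto intro: vec.span_base)
    then have "(y + (- c) *s x0) + c *s x0 \<in> ?S"
      by (rule vec.span_add[OF _ vec.span_scale])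
    moreover have "(y + (- c) *s x0) + c *s x0 = y" by (simp add: vec_eq_iff)
    ultimately show ?thesis by (simp only:)
  qed
  have "polar A x0 \<noteq> 0" using assms unfolding nondeg_iff by blast
  then obtain y1 where y1: "dot (polar A x0) y1 \<noteq> 0"
    using dot_all_zero[of "polar A x0"] by blast
  have "y \<in> ?S" for y
  proof (cases "dot (polar A x0) y = 0")
    case True
    then have "y + y1 \<in> ?S" "y1 \<in> ?S"
      using y1 by (auto intro!: off simp: dot_linear)
    then have "(y + y1) - y1 \<in> ?S" by (rule vec.span_diff)
    then show ?thesis by simp
  qed (rule off)
  then show ?thesis by blast
qed

section \<open>Homogeneous coordinates and the quadric of a matrix\<close>

definition pt :: "'a ^ 3 \<Rightarrow> 'a \<Rightarrow> 'a ^ 4" where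
  "pt x z = (\<chi> i. if i = 3 then z else if i = 0 then x $ 0 else if i = 1 then x $ 1 else x $ 2)"

lemma pt_nth [simp]: "pt x z $ 0 = x $ 0" "pt x z $ 1 = x $ 1" "pt x z $ 2 = x $ 2" "pt x z $ 3 = z"
  by (simp_all add: pt_def)

lemma pt_cases: obtains x z where "v = pt x z"
proof
  show "v = pt (\<chi> i. v $ idx3 i) (v $ 3)"
    by (simp add: vec4_eq_iff idx3_def)
qed

lemma pt_eq_iff: "pt x z = pt x' z' \<longleftrightarrow> x = x' \<and> z = z'"
  by (auto simp: vec4_eq_iff vec3_eq_iff)

lemma pt_eq_0_iff: "pt x z = 0 \<longleftrightarrow> x = 0 \<and> z = 0"
  by (auto simp: vec4_eq_iff vec3_eq_iff)

lemma pt_linear: "pt x z + pt x' z' = pt (x + x') (z + z')" "c *s pt x z = pt (c *s x) (c * z)"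
  by (simp_all add: vec4_eq_iff)

text \<open>The affine points \<open>y\<close> of this quadric are those with \<open>det (A + crossm y) = 0\<close>; its other
  points are the zeros of \<open>A\<close>.\<close>
definition quad :: "'a::comm_ring_1 ^ 3 ^ 3 \<Rightarrow> 'a ^ 4 ^ 4" where
  "quad A = (\<chi> i j.
     if j = 3 then
       if i = 3 then det A
       else if i = 0 then A $ 0 $ 0 * (A $ 2 $ 1 - A $ 1 $ 2) + A $ 0 $ 2 * A $ 1 $ 0 - A $ 0 $ 1 * A $ 2 $ 0
       else if i = 1 then A $ 1 $ 1 * (A $ 0 $ 2 - A $ 2 $ 0) + A $ 1 $ 0 * A $ 2 $ 1 - A $ 0 $ 1 * A $ 1 $ 2
       else A $ 2 $ 2 * (A $ 1 $ 0 - A $ 0 $ 1) + A $ 0 $ 2 * A $ 2 $ 1 - A $ 1 $ 2 * A $ 2 $ 0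
     else if i = 3 then 0
     else A $ (if i = 0 then 0 else if i = 1 then 1 else 2) $ (if j = 0 then 0 else if j = 1 then 1 else 2))"

lemma restr_pi_quad: "restr_pi (quad A) = A"
  by (simp add: vec3_eq_iff restr_pi_def quad_def idx3_def)

lemma qform_quad_0: "qform (quad A) (pt y 0) = qform A y"
  by (simp add: qform_def sum_UNIV_4 sum_UNIV_3 quad_def)

text \<open>The determinant has degree only two in \<open>y\<close>: its cubic part is the
  determinant of the alternating matrix \<open>crossm y\<close>, which is 0, and its quadratic part
  is \<open>qform A y\<close>.\<close>

lemma qform_quad_1: "qform (quad A) (pt y 1) = det (A + crossm y)"
  by (simp add: qform_def sum_UNIV_4 quad_def det_UNIV_3 crossm_nth algebra_simps)

section \<open>Planes of \<open>PG(5,q)\<close> as graphs of \<open>3 \<times> 3\<close> matrices\<close>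

lemma lspan_eq_span: "lspan S = vec.span S"
  unfolding lspan_def vec.span_explicit by blast

lemma lspan_pair: "lspan {u, v} = {a *s u + b *s v | a b. True}"
  unfolding lspan_eq_span vec.span_insert vec.span_singleton
  by (auto simp: algebra_simps)

lemma lspan_pairI: "x = a *s u + b *s v \<Longrightarrow> x \<in> lspan {u, v}"
  by (auto simp: lspan_pair)

text \<open>\<open>cross w x\<close> is orthogonal to \<open>x\<close>. Moving the affine origin to
  \<open>w\<close>, which replaces \<open>A\<close> by \<open>A + crossm w\<close>, therefore keeps
  the conic at infinity.\<close>

lemma qform_crossm [simp]: "qform (A + crossm w) x = qform A x"
  by (simp add: qform_dot matrix_vector_mult_add_rdistrib dot_linear)

lemma polar_crossm [simp]: "polar (A + crossm w) x = polar A x"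
proof -
  have "transpose (A + crossm w) = transpose A - crossm w"
    by (simp add: vec3_eq_iff transpose_def crossm_nth)
  then show ?thesis
    by (simp add: polar_def matrix_vector_mult_add_rdistrib matrix_vector_mult_diff_rdistrib)
qed

lemma nondeg_crossm [simp]: "nondeg (A + crossm w) \<longleftrightarrow> nondeg A"
  by (simp add: nondeg_iff)

text \<open>The lines off the plane \<open>x\<^sub>4 = 0\<close> are those spanned by a point at infinity \<open>x\<close> and an
  affine point \<open>y\<close>.\<close>
definition aline :: "'a::field ^ 3 \<Rightarrow> 'a ^ 3 \<Rightarrow> ('a ^ 4) set" where
  "aline x y = lspan {pt x 0, pt y 1}"

lemma mem_aline: "v \<in> aline x y \<longleftrightarrow> (\<exists>a b. v = pt (a *s x + b *s y) b)"
  by (auto simp: aline_def lspan_pair pt_linear)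

lemma is_line_aline: "x \<noteq> 0 \<Longrightarrow> is_line (aline x y)"
  unfolding is_line_def aline_def
  by (intro exI[of _ "pt x 0"] exI[of _ "pt y 1"]) (auto simp: pt_linear pt_eq_0_iff)

lemma is_line_cases:
  assumes "is_line L"
  obtains (infinite) u v where "cross u v \<noteq> 0" "L = lspan {pt u 0, pt v 0}"
        | (affine) x y where "x \<noteq> 0" "L = aline x y"
proof -
  obtain u v where ind: "\<And>a b. a *s u + b *s v = 0 \<Longrightarrow> a = 0 \<and> b = 0" and L: "L = lspan {u, v}"
    using assms unfolding is_line_def by blast
  obtain u' a where u: "u = pt u' a" by (rule pt_cases)
  obtain v' b where v: "v = pt v' b" by (rule pt_cases)
  \<comment> \<open>A point with nonzero last coordinate is scaled to an affine point
    \<open>y\<close>, and a multiple of it is subtracted from the other point to reach infinity. The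
    claim is stated for arbitrary pairs because it is also applied with \<open>u\<close> and
    \<open>v\<close> exchanged.\<close>
  have main: "\<exists>x y. x \<noteq> 0 \<and> L = aline x y"
    if ind: "\<And>a b. a *s pt u' a1 + b *s pt v' b1 = 0 \<Longrightarrow> a = 0 \<and> b = 0"
      and L: "L = lspan {pt u' a1, pt v' b1}" and b: "b1 \<noteq> 0" for u' v' a1 b1
  proof -
    define y where "y = (1 / b1) *s v'"
    define x where "x = u' + (- a1) *s y"
    have v': "v' = b1 *s y" and u': "u' = x + a1 *s y"
      using b by (simp_all add: x_def y_def vec_eq_iff)
    have "x \<noteq> 0"
    proof
      assume "x = 0"
      then have "1 *s pt u' a1 + (- a1 / b1) *s pt v' b1 = 0"
        using b by (simp add: u' v' vec4_eq_iff)
      from ind[OF this] show False by simp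
    qed
    moreover have "L = aline x y"
      unfolding L aline_def lspan_eq_span vec.span_eq
    proof (simp flip: lspan_eq_span, intro conjI)
      show "pt u' a1 \<in> lspan {pt x 0, pt y 1}"
        by (rule lspan_pairI[of _ 1 _ a1]) (simp add: u' vec4_eq_iff)
      show "pt v' b1 \<in> lspan {pt x 0, pt y 1}"
        by (rule lspan_pairI[of _ 0 _ b1]) (simp add: v' vec4_eq_iff)
      show "pt x 0 \<in> lspan {pt u' a1, pt v' b1}"
        using b by (intro lspan_pairI[of _ 1 _ "- a1 / b1"]) (simp add: u' v' vec4_eq_iff)
      show "pt y 1 \<in> lspan {pt u' a1, pt v' b1}"
        using b by (intro lspan_pairI[of _ 0 _ "1 / b1"]) (simp add: v' vec4_eq_iff)
    qed
    ultimately show ?thesis by blast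
  qed
  consider "b \<noteq> 0" | "a \<noteq> 0" | "a = 0" "b = 0" by blast
  then show ?thesis
  proof cases
    case 1
    then show ?thesis using main[of u' a v' b] ind L affine unfolding u v by blast
  next
    case 2
    have "L = lspan {v, u}" using L by (simp add: insert_commute)
    moreover have "d = 0 \<and> c = 0" if "d *s v + c *s u = 0" for c d
      using ind[of c d] that by (simp add: add.commute)
    ultimately show ?thesis using main[of v' b u' a] 2 affine unfolding u v by blast
  next
    case 3
    have "cross u' v' \<noteq> 0"
    proof
      assume c: "cross u' v' = 0"
      show False
      proof (cases "v' = 0")
        case True
        then show False using ind[of 0 1] 3 by (simp add: v pt_eq_0_iff)
      next
        case False
        then obtain e where "u' = e *s v'" using cross_eq_0_imp c by blast
        then show False using ind[of 1 "- e"] 3 by (simp add: u v vec4_eq_iff)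
      qed
    qed
    then show ?thesis using infinite L 3 unfolding u v by blast
  qed
qed

section \<open>The two rulings of the quadric\<close>

lemma flag_exists:
  fixes A :: "'a::field ^ 3 ^ 3"
  assumes "qform A x = 0" "x \<noteq> 0"
  shows "\<exists>y. (A + crossm y) *v x = 0"
proof -
  \<comment> \<open>A zero of the form is orthogonal to its image under \<open>A\<close>.\<close>
  obtain y where "A *v x = cross x y"
    using orthogonal_imp_cross[of x "A *v x"] assms by (auto simp: qform_dot)
  then show ?thesis
    by (intro exI[of _ y]) (simp add: matrix_vector_mult_add_rdistrib cross_commute[of y])
qed

lemma flag_isotropic: "(A + crossm y) *v x = 0 \<Longrightarrow> qform A x = 0"
  by (metis qform_crossm qform_dot dot_zero(2))

text \<open>Moving \<open>y\<close> along the direction \<open>x\<close> does not change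
  \<open>cross y x\<close>, so at every affine point of the line the matrix has \<open>x\<close> in
  its kernel.\<close>

lemma aline_in_qlines:
  assumes x: "x \<noteq> 0" and flag: "(A + crossm y) *v x = 0"
  shows "aline x y \<in> qlines (quad A)"
proof -
  have "qform (quad A) v = 0" if v: "v \<in> aline x y" for v
  proof -
    obtain a b where v: "v = pt (a *s x + b *s y) b" using v mem_aline by blast
    show ?thesis
    proof (cases "b = 0")
      case True
      then show ?thesis using flag_isotropic[OF flag] by (simp add: v qform_quad_0 qform_smult)
    next
      case False
      define t where "t = (a / b) *s x"
      have "a *s x = b *s t" using False by (simp add: t_def vec_eq_iff)
      then have v': "v = b *s pt (t + y) 1"
        by (simp add: v vec4_eq_iff algebra_simps)
      have "(A + crossm (t + y)) *v x = (A + crossm y) *v x + cross t x"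
        by (simp add: matrix_vector_mult_add_rdistrib cross_add_left)
      also have "\<dots> = 0" by (simp add: flag t_def cross_smult_left)
      finally have "det (A + crossm (t + y)) = 0"
        using x det_eq_0_iff_kernel by blast
      then show ?thesis unfolding v' qform_smult by (simp add: qform_quad_1)
    qed
  qed
  with is_line_aline[OF x] show ?thesis by (simp add: qlines_def)
qed

text \<open>For \<open>B = A + crossm w\<close>: a line of the quadric through its affine point \<open>w\<close> with direction \<open>x\<close>
  belongs to one of the two rulings.\<close>
lemma ruling_dichotomy:
  fixes B :: "'a::field ^ 3 ^ 3"
  assumes nd: "nondeg B" and x: "x \<noteq> 0" "qform B x = 0"
    and det: "det B = 0" "det (B + crossm x) = 0"
  shows "B *v x = 0 \<or> transpose B *v x = 0"
proof -
  obtain m where m: "m \<noteq> 0" "transpose B *v m = 0"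
    using det(1) det_eq_0_iff_kernel[of "transpose B"] by auto
  obtain k where k: "k \<noteq> 0" "(B + crossm x) *v k = 0"
    using det(2) det_eq_0_iff_kernel by blast
  then have Bk: "B *v k = cross k x"
    by (simp add: matrix_vector_mult_add_rdistrib cross_commute[of k] eq_neg_iff_add_eq_0)
  define p where "p = B *v x"
  have mB: "dot m (B *v z) = 0" for z by (simp only: dot_transpose m dot_zero)
  \<comment> \<open>\<open>m\<close> is orthogonal to the image of \<open>B\<close>, which contains
    \<open>cross k x\<close>, so \<open>m\<close>, \<open>k\<close>, \<open>x\<close> are
    coplanar.\<close>
  obtain a b c where abc: "a \<noteq> 0 \<or> b \<noteq> 0 \<or> c \<noteq> 0" "a *s m + b *s k + c *s x = 0"
    using coplanar_dependent[of m k x] mB[of k] Bk by auto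
  \<comment> \<open>If \<open>k\<close> is orthogonal to \<open>B *v x\<close>, then
    \<open>k\<close> and \<open>x\<close> are conjugate zeros, hence proportional. Then
    \<open>B *v k\<close>, being \<open>cross k x\<close>, vanishes, and so does
    \<open>B *v x\<close>.\<close>
  have par: "B *v x = 0" if kp: "dot k p = 0"
  proof -
    have "dot (polar B x) k = dot x (B *v k) + dot k (B *v x)"
      by (simp only: dot_transpose[of x] polar_def dot_add_left) (simp add: dot_commute)
    then have "dot (polar B k) x = 0"
      using kp by (simp add: Bk p_def dot_polar_commute)
    moreover have "qform B k = 0" by (simp add: qform_dot Bk)
    ultimately have "cross k x = 0" using nondeg_no_line[OF nd] x(2) by blast
    then obtain t where t: "k = t *s x" using cross_eq_0_imp x(1) by blast
    then have "t *s (B *v x) = 0" using \<open>cross k x = 0\<close> Bk by (simp add: vec.scale)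
    with t k(1) show ?thesis by auto
  qed
  have "dot m p = 0" "dot x p = 0" using mB x(2) by (simp_all add: p_def qform_dot)
  moreover have "dot (a *s m + b *s k + c *s x) p = 0" by (simp add: abc)
  ultimately have bkp: "b = 0 \<or> dot k p = 0" by (simp add: dot_linear)
  show ?thesis
  proof (cases "dot k p = 0")
    case True
    then show ?thesis using par by blast
  next
    case False
    then have "b = 0" using bkp by blast
    \<comment> \<open>With \<open>b = 0\<close> the dependence makes \<open>x\<close> a multiple of
      the left kernel vector \<open>m\<close>.\<close>
    then have mx: "a *s m = (- c) *s x" using abc(2) by (simp add: eq_neg_iff_add_eq_0)
    have "c \<noteq> 0" using mx abc(1) m(1) \<open>b = 0\<close> by auto
    have "(- c) *s (transpose B *v x) = a *s (transpose B *v m)"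
      by (simp only: mx flip: vec.scale)
    then show ?thesis using \<open>c \<noteq> 0\<close> m(2) by (simp add: vec_eq_iff)
  qed
qed

text \<open>The left kernel vector \<open>x\<close> is orthogonal to
  \<open>(A + crossm w) *v x0\<close>, which equals \<open>cross (w - y0) x0\<close>. The resulting
  dependence of \<open>x\<close>, \<open>w - y0\<close>, \<open>x0\<close> is a common point of the
  lines, at infinity if \<open>b = 0\<close>.\<close>

lemma opposite_rulings_meet:
  fixes A :: "'a::field ^ 3 ^ 3"
  assumes x: "x \<noteq> 0" "transpose (A + crossm w) *v x = 0"
    and x0: "x0 \<noteq> 0" "(A + crossm y0) *v x0 = 0"
  shows "aline x w \<inter> aline x0 y0 \<noteq> {0}"
proof -
  have "(A + crossm w) *v x0 = (A + crossm y0) *v x0 + cross (w - y0) x0"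
    by (simp add: matrix_vector_mult_add_rdistrib vec3_eq_iff algebra_simps)
  moreover have "dot x ((A + crossm w) *v x0) = 0" by (simp only: dot_transpose x dot_zero)
  ultimately have "dot x (cross (w - y0) x0) = 0" by (simp add: x0)
  then obtain a b c where abc: "a \<noteq> 0 \<or> b \<noteq> 0 \<or> c \<noteq> 0" "a *s x + b *s (w - y0) + c *s x0 = 0"
    using coplanar_dependent[of x "w - y0" x0] by blast
  define z where "z = pt (a *s x + b *s w) b"
  have eq: "a *s x + b *s w = (- c) *s x0 + b *s y0"
  proof -
    have "a *s x + b *s w - ((- c) *s x0 + b *s y0) = a *s x + b *s (w - y0) + c *s x0"
      by (simp add: vec_eq_iff algebra_simps)
    with abc(2) show ?thesis by simp
  qed
  have "z \<in> aline x w" unfolding z_def mem_aline by blast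
  moreover have "z \<in> aline x0 y0" unfolding z_def eq mem_aline by blast
  moreover have "z \<noteq> 0"
    using abc(1) eq x(1) x0(1) by (auto simp: z_def pt_eq_0_iff)
  ultimately show ?thesis by blast
qed

text \<open>Kernel vectors of \<open>B\<close> are zeros of its form and conjugate to each other, so
  the kernel has dimension at most one.\<close>

lemma not_parallel_isotropic:
  fixes B :: "'a::field ^ 3 ^ 3"
  assumes "nondeg B" "B *v x = 0" "B *v x' = 0"
  shows "cross x x' = 0"
proof (rule nondeg_no_line[OF assms(1)])
  have "dot (polar B x) x' = dot x (B *v x') + dot x' (B *v x)"
    by (simp only: dot_transpose[of x] polar_def dot_add_left) (simp add: dot_commute)
  then show "dot (polar B x) x' = 0" by (simp add: assms)
qed (simp_all add: qform_dot assms)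

text \<open>A singular point at infinity would be singular for the conic. A singular affine point
  would force all zeros of the conic into the kernel of \<open>B\<close> or of its transpose, too
  few directions to span the space unless the two kernels coincide, and then the kernel vector is
  singular for \<open>B\<close>.\<close>

lemma nondeg_quad:
  fixes A :: "'a::field ^ 3 ^ 3"
  assumes nd: "nondeg A" and x0: "x0 \<noteq> 0" "qform A x0 = 0"
  shows "nondeg (quad A)"
  unfolding nondeg_def
proof
  assume "\<exists>v. v \<noteq> 0 \<and> qform (quad A) v = 0 \<and>
    (\<forall>y. qform (quad A) (v + y) - qform (quad A) v - qform (quad A) y = 0)"
  then obtain v where v: "v \<noteq> 0" "qform (quad A) v = 0"
    and "\<And>y. qform (quad A) (v + y) - qform (quad A) v - qform (quad A) y = 0" by blast
  then have rad: "polar (quad A) v = 0" by (simp add: qform_add flip: dot_all_zero)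
  obtain x z where vxz: "v = pt x z" by (rule pt_cases)
  show False
  proof (cases "z = 0")
    case True
    have "qform A (x + y) - qform A x - qform A y = 0" for y
      using qform_add[of "quad A" v "pt y 0"] rad
      by (simp add: vxz True pt_linear qform_quad_0)
    moreover have "qform A x = 0" "x \<noteq> 0"
      using v by (auto simp: vxz True qform_quad_0 pt_eq_0_iff)
    ultimately show False using nd unfolding nondeg_def by blast
  next
    case False
    define w where "w = (1 / z) *s x"
    have w: "pt w 1 = (1 / z) *s v" using False by (simp add: vxz w_def pt_linear)
    define B where "B = A + crossm w"
    have ndB: "nondeg B" using nd by (simp add: B_def)
    have detB: "det B = 0"
      unfolding B_def qform_quad_1[symmetric] w qform_smult v by simp
    \<comment> \<open>The polar vector vanishes at \<open>pt w 1\<close>, a zero of the quadric, so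
      only the value at infinity remains.\<close>
    have "det (B + crossm y) = qform A y" for y
    proof -
      have "det (B + crossm y) = qform (quad A) (pt w 1 + pt y 0)"
        by (simp add: B_def pt_linear qform_quad_1 crossm_add add.assoc)
      also have "\<dots> = qform A y"
        unfolding qform_add w polar_linear rad qform_smult v by (simp add: qform_quad_0)
      finally show ?thesis .
    qed
    then have dich: "B *v y = 0 \<or> transpose B *v y = 0" if "qform A y = 0" for y
      using ruling_dichotomy[OF ndB _ _ detB, of y] that by (cases "y = 0") (simp_all add: B_def)
    obtain k where k: "k \<noteq> 0" "B *v k = 0" using detB det_eq_0_iff_kernel by blast
    obtain m where m: "m \<noteq> 0" "transpose B *v m = 0"
      using detB det_eq_0_iff_kernel[of "transpose B"] by auto
    have ndT: "nondeg (transpose B)"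
    proof -
      have "qform (transpose B) = qform B"
        by (rule ext) (simp only: qform_dot dot_transpose[of _ B] dot_commute)
      then show ?thesis using ndB by (simp add: nondeg_def)
    qed
    have "dot (cross k m) y = 0" if y: "qform A y = 0" for y
    proof -
      have "cross y k = 0 \<or> cross y m = 0"
        using dich[OF y] not_parallel_isotropic[OF ndB _ k(2)]
          not_parallel_isotropic[OF ndT _ m(2)] by blast
      then obtain t where "y = t *s k \<or> y = t *s m"
        using cross_eq_0_imp k(1) m(1) by blast
      then show ?thesis by (auto simp: dot_linear)
    qed
    then have "{y. qform A y = 0} \<subseteq> {y. dot (cross k m) y = 0}" by blast
    moreover have "vec.subspace {y. dot (cross k m) y = 0}"
      by (simp add: vec.subspace_def dot_linear)
    ultimately have "vec.span {y. qform A y = 0} \<subseteq> {y. dot (cross k m) y = 0}"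
      by (rule vec.span_minimal)
    then have "\<forall>y. dot (cross k m) y = 0"
      using isotropic_span[OF nd x0] by blast
    then have "cross k m = 0" by (simp add: dot_all_zero)
    then obtain t where t: "k = t *s m" using cross_eq_0_imp m(1) by blast
    have "transpose B *v k = t *s (transpose B *v m)" by (simp only: t vec.scale)
    then have "polar B k = 0" by (simp only: polar_def k m) simp
    moreover have "qform B k = 0" by (simp add: qform_dot k)
    ultimately show False using ndB k(1) unfolding nondeg_iff by blast
  qed
qed

section \<open>Pluecker coordinates and the planes of reguli\<close>

definition gvec :: "'a::comm_ring_1 ^ 3 ^ 3 \<Rightarrow> 'a ^ 3 \<Rightarrow> 'a ^ 6" where
  "gvec A x = (\<chi> k. if k = 0 then (A *v x) $ 2 else if k = 1 then - (A *v x) $ 1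
     else if k = 2 then x $ 0 else if k = 3 then (A *v x) $ 0
     else if k = 4 then x $ 1 else x $ 2)"

lemma gvec_linear: "gvec A x + gvec A y = gvec A (x + y)" "c *s gvec A x = gvec A (c *s (x :: 'a::field ^ 3))"
  by (simp_all add: vec_eq_iff[where 'b = 6] gvec_def matrix_vector_right_distrib vec.scale)

lemma gvec_eq_iff: "gvec A x = gvec B y \<longleftrightarrow> x = y \<and> A *v x = B *v y"
  by (auto simp: vec_eq_iff[where 'b = 6] all_6 vec3_eq_iff gvec_def)

lemma gvec_eq_0_iff: "gvec A x = 0 \<longleftrightarrow> x = 0"
proof
  assume "gvec A x = 0"
  then show "x = 0" by (simp add: vec_eq_iff[where 'b = 6] all_6 gvec_def vec3_eq_iff)
qed (simp add: vec_eq_iff[where 'b = 6] gvec_def)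

text \<open>The coordinates run over the index pairs 01, 02, 03, 12, 13, 23: positions 2, 4, 5 give
  \<open>x\<close>, the others give \<open>cross x y\<close> up to order and sign. The flag
  condition says that \<open>cross x y\<close> is \<open>A *v x\<close>.\<close>

lemma plucker_flag:
  assumes "(A + crossm y) *v x = 0"
  shows "plucker (pt x 0) (pt y 1) = gvec A x"
proof -
  have "A *v x = - cross y x"
    using assms by (simp add: matrix_vector_mult_add_rdistrib eq_neg_iff_add_eq_0)
  then show ?thesis
    by (simp add: vec_eq_iff[where 'b = 6] all_6 plucker_def gvec_def pl_i_def pl_j_def)
qed

text \<open>Replacing the pair by two combinations multiplies the Pluecker vector by their
  determinant, so the Pluecker vectors of all pairs already form a subspace.\<close>

lemma klein_line: "klein (lspan {u, v}) = lspan {plucker u v}"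
proof -
  have pl: "plucker (a *s u + b *s v) (c *s u + d *s v) = (a * d - b * c) *s plucker u v" for a b c d
    by (simp add: vec_eq_iff plucker_def algebra_simps)
  have "{plucker x y | x y. x \<in> lspan {u, v} \<and> y \<in> lspan {u, v}} = lspan {plucker u v}" (is "?S = _")
  proof
    show "?S \<subseteq> lspan {plucker u v}"
    proof
      fix p assume "p \<in> ?S"
      then obtain a b c d where "p = plucker (a *s u + b *s v) (c *s u + d *s v)"
        unfolding lspan_pair by blast
      then have "p = (a * d - b * c) *s plucker u v" by (simp only: pl)
      then show "p \<in> lspan {plucker u v}" unfolding lspan_eq_span vec.span_singleton by blast
    qed
    show "lspan {plucker u v} \<subseteq> ?S"
    proof
      fix p assume "p \<in> lspan {plucker u v}"
      then obtain c where "p = c *s plucker u v"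
        by (auto simp: lspan_eq_span vec.span_singleton)
      then have "p = plucker (c *s u + 0 *s v) (0 *s u + 1 *s v)" by (simp only: pl) simp
      then show "p \<in> ?S" unfolding lspan_pair by blast
    qed
  qed
  then show ?thesis by (simp add: klein_def lspan_eq_span)
qed

lemma klein_aline: "(A + crossm y) *v x = 0 \<Longrightarrow> klein (aline x y) = lspan {gvec A x}"
  by (simp add: aline_def klein_line plucker_flag)

text \<open>A line at infinity would lie on a nondegenerate conic. An affine line belongs to one of
  the rulings, and those of the opposite ruling meet the given line.\<close>

lemma regulus_members:
  fixes A :: "'a::field ^ 3 ^ 3"
  assumes nd: "nondeg A" and x0: "x0 \<noteq> 0" and flag: "(A + crossm y0) *v x0 = 0"
    and L: "L \<in> regulus_of (quad A) (aline x0 y0)"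
  shows "\<exists>x y. L = aline x y \<and> (A + crossm y) *v x = 0"
proof (cases "L = aline x0 y0")
  case False
  then have disj: "L \<inter> aline x0 y0 = {0}" and line: "is_line L"
    and zero: "\<And>v. v \<in> L \<Longrightarrow> qform (quad A) v = 0"
    using L by (auto simp: regulus_of_def qlines_def)
  from line show ?thesis
  proof (cases rule: is_line_cases)
    case (infinite u v)
    have q: "qform A (a *s u + b *s v) = 0" for a b
    proof -
      have "pt (a *s u + b *s v) 0 \<in> L"
        unfolding infinite by (rule lspan_pairI[of _ a _ b]) (simp add: pt_linear)
      from zero[OF this] show ?thesis by (simp add: qform_quad_0)
    qed
    have "qform A u = 0" "qform A v = 0" "qform A (u + v) = 0"
      using q[of 1 0] q[of 0 1] q[of 1 1] by simp_all
    then show ?thesis using nondeg_no_line[OF nd, of u v] infinite(1) by (simp add: qform_add)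
  next
    case (affine x w)
    have q: "qform (quad A) (pt (a *s x + b *s w) b) = 0" for a b
      using zero affine(2) mem_aline by blast
    have "qform A x = 0" "det (A + crossm w) = 0" "det (A + crossm w + crossm x) = 0"
      using q[of 1 0] q[of 0 1] q[of 1 1]
      by (simp_all add: qform_quad_0 qform_quad_1 crossm_add add_ac)
    then have "(A + crossm w) *v x = 0 \<or> transpose (A + crossm w) *v x = 0"
      using ruling_dichotomy[of "A + crossm w" x] nd affine(1) by simp
    then show ?thesis
      using opposite_rulings_meet[OF affine(1) _ x0 flag] disj affine(2) by blast
  qed
qed (use flag in blast)

text \<open>A common point at infinity would make \<open>x\<close> and \<open>x0\<close>
  proportional. At a common affine point \<open>w\<close>, both would lie in the kernel of
  \<open>A + crossm w\<close>.\<close>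

lemma aline_in_regulus:
  fixes A :: "'a::field ^ 3 ^ 3"
  assumes nd: "nondeg A" and flag0: "(A + crossm y0) *v x0 = 0" and flag: "(A + crossm y) *v x = 0"
    and np: "cross x x0 \<noteq> 0"
  shows "aline x y \<in> regulus_of (quad A) (aline x0 y0)"
proof -
  have nz: "x \<noteq> 0" "x0 \<noteq> 0" using np by auto
  have "v = 0" if v: "v \<in> aline x y" "v \<in> aline x0 y0" for v
  proof -
    obtain a b where 1: "v = pt (a *s x + b *s y) b" using v mem_aline by blast
    obtain c d where 2: "v = pt (c *s x0 + d *s y0) d" using v mem_aline by blast
    have bd: "d = b" and eq: "a *s x + b *s y = c *s x0 + b *s y0"
      using 1 2 by (auto simp: pt_eq_iff)
    show ?thesis
    proof (cases "b = 0")
      case True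
      then have "a *s cross x x0 = 0"
        using eq by (simp add: cross_smult_left[symmetric])
          (simp add: cross_smult_left)
      then have "a = 0" using np by simp
      then show ?thesis by (simp add: 1 True vec4_eq_iff)
    next
      case False
      define w where "w = y + (a / b) *s x"
      have "b *s w = b *s (y0 + (c / b) *s x0)"
        using eq False by (simp add: w_def vec_eq_iff algebra_simps)
      then have w0: "w = y0 + (c / b) *s x0" using False vec.scale_cancel_left by blast
      have "(A + crossm w) *v x = 0"
        using flag by (simp add: w_def crossm_add matrix_vector_mult_add_rdistrib cross_smult_left
            flip: add.assoc)
      moreover have "(A + crossm w) *v x0 = 0"
        using flag0 by (simp add: w0 crossm_add matrix_vector_mult_add_rdistrib cross_smult_left
            flip: add.assoc)
      ultimately show ?thesis
        using not_parallel_isotropic[of "A + crossm w" x x0] nd np by simp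
    qed
  qed
  moreover have "0 \<in> aline x y" "0 \<in> aline x0 y0"
    by (simp_all add: aline_def lspan_eq_span vec.span_zero)
  ultimately have "aline x y \<inter> aline x0 y0 = {0}" by blast
  then show ?thesis
    using aline_in_qlines[OF nz(1) flag] by (simp add: regulus_of_def)
qed

lemma klein_span_regulus:
  fixes A :: "'a::field ^ 3 ^ 3"
  assumes nd: "nondeg A" and x0: "x0 \<noteq> 0" and flag: "(A + crossm y0) *v x0 = 0"
  shows "klein_span (regulus_of (quad A) (aline x0 y0)) = range (gvec A)"
proof
  let ?R = "regulus_of (quad A) (aline x0 y0)"
  have sub: "vec.subspace (range (gvec A))"
  proof (rule vec.subspaceI)
    show "0 \<in> range (gvec A)"
      using gvec_eq_0_iff[of A 0] by (metis rangeI)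
  qed (auto simp: gvec_linear)
  have "klein L \<subseteq> range (gvec A)" if "L \<in> ?R" for L
  proof -
    obtain x y where "L = aline x y" "(A + crossm y) *v x = 0"
      using regulus_members[OF nd x0 flag \<open>L \<in> ?R\<close>] by blast
    then have "klein L = lspan {gvec A x}" by (simp add: klein_aline)
    also have "\<dots> \<subseteq> range (gvec A)"
      unfolding lspan_eq_span using sub by (intro vec.span_minimal) auto
    finally show ?thesis .
  qed
  then show "klein_span ?R \<subseteq> range (gvec A)"
    unfolding klein_span_def lspan_eq_span using sub by (intro vec.span_minimal) auto
  let ?K = "klein_span ?R"
  have K: "klein L \<subseteq> ?K" if "L \<in> ?R" for L
    using that by (auto simp: klein_span_def lspan_eq_span intro: vec.span_base)
  have gK: "gvec A x \<in> ?K" if "(A + crossm y) *v x = 0" "aline x y \<in> ?R" for x y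
    using K[OF that(2)] klein_aline[OF that(1)] by (auto simp: lspan_eq_span intro: vec.span_base)
  have subK: "vec.subspace ?K" by (simp add: klein_span_def lspan_eq_span vec.subspace_span)
  have g0: "gvec A x0 \<in> ?K"
    using flag aline_in_qlines[OF x0 flag] by (intro gK) (auto simp: regulus_of_def)
  \<comment> \<open>Zeros proportional to \<open>x0\<close> come from the given line, all others
    from lines of the regulus disjoint from it. Since the zeros span the space, the whole graph is
    reached.\<close>
  have "gvec A x \<in> ?K" if "qform A x = 0" for x
  proof (cases "cross x x0 = 0")
    case True
    then obtain t where "x = t *s x0" using cross_eq_0_imp x0 by blast
    then show ?thesis using g0 subK by (simp add: gvec_linear[symmetric] vec.subspace_scale)
  next
    case False
    then have "x \<noteq> 0" by auto
    then obtain y where "(A + crossm y) *v x = 0" using flag_exists \<open>qform A x = 0\<close> by blast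
    then show ?thesis using aline_in_regulus[OF nd flag _ False] gK by blast
  qed
  then have "{x. qform A x = 0} \<subseteq> {x. gvec A x \<in> ?K}" by blast
  moreover have "vec.subspace {x. gvec A x \<in> ?K}"
    using subK gvec_eq_0_iff[of A 0]
    by (auto simp: vec.subspace_def gvec_linear[symmetric])
  ultimately have "vec.span {x. qform A x = 0} \<subseteq> {x. gvec A x \<in> ?K}"
    by (rule vec.span_minimal)
  then show "range (gvec A) \<subseteq> ?K"
    using isotropic_span[OF nd x0 flag_isotropic[OF flag]] by blast
qed

lemma graph_in_S1:
  assumes circ: "A \<in> circ_bundle emb s" and x0: "x0 \<noteq> 0" "qform A x0 = 0"
  shows "range (gvec A) \<in> S1 emb s"
proof -
  have nd: "nondeg A" using circ by (simp add: circ_bundle_def)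
  obtain y0 where y0: "(A + crossm y0) *v x0 = 0" using flag_exists x0 by blast
  have line: "aline x0 y0 \<in> qlines (quad A)" by (rule aline_in_qlines[OF x0(1) y0])
  then have "quad A \<in> hyp_set emb s"
    using nondeg_quad[OF nd x0] circ by (auto simp: hyp_set_def hyperbolic_def restr_pi_quad)
  moreover have "regulus_of (quad A) (aline x0 y0) \<in> reguli (quad A)"
    using line by (auto simp: reguli_def)
  ultimately show ?thesis
    using klein_span_regulus[OF nd x0(1) y0] by (auto simp: S1_def)
qed

section \<open>The cubic extension\<close>

lemma power_CARD_eq:
  fixes x :: "'a::{field,finite}"
  shows "x ^ CARD('a) = x"
proof (cases "x = 0")
  case False
  have "x ^ (CARD('a) - 1) * \<Prod>(UNIV - {0}) = (\<Prod>y\<in>UNIV - {0}. x * y)"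
    by (simp add: prod.distrib)
  also have "\<dots> = \<Prod>(UNIV - {0})"
    by (rule prod.reindex_bij_witness[of _ "\<lambda>y. y / x" "\<lambda>y. x * y"]) (use False in auto)
  finally have "x ^ (CARD('a) - 1) = 1" by simp
  then have "x * x ^ (CARD('a) - 1) = x" by simp
  moreover have "Suc (CARD('a) - 1) = CARD('a)" by simp
  ultimately show ?thesis by (metis power_Suc)
qed (simp add: power_0_left)

lemma CARD_field_ge_2: "2 \<le> CARD('a::{field,finite})"
  using card_mono[of "UNIV :: 'a set" "{0, 1}"] by simp

lemma card_roots_eq_0:
  fixes p :: "'a::{field,finite} poly"
  assumes "\<And>x. poly p x = 0" "degree p < CARD('a)"
  shows "p = 0"
  using card_poly_roots_bound[of p] assms by fastforce

text \<open>\<open>(X + 1) ^ q - X ^ q - 1\<close> has degree less than \<open>q\<close> but vanishes on the whole field.\<close>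
lemma binomial_CARD_eq_0:
  assumes "0 < i" "i < CARD('a)"
  shows "of_nat (CARD('a) choose i) = (0 :: 'a::{field,finite})"
proof -
  let ?q = "CARD('a)"
  define p :: "'a poly" where "p = (\<Sum>k\<in>{1..<?q}. monom (of_nat (?q choose k)) k)"
  have q: "2 \<le> ?q" by (rule CARD_field_ge_2)
  have split: "{..?q} = insert 0 (insert ?q {1..<?q})" using q by auto
  have "poly p x = 0" for x
  proof -
    have "x + 1 = (x + 1) ^ ?q" by (simp add: power_CARD_eq)
    also have "\<dots> = (\<Sum>k\<le>?q. of_nat (?q choose k) * x ^ k)"
      unfolding binomial_ring by simp
    also have "\<dots> = 1 + (x ^ ?q + poly p x)"
      unfolding split using q by (simp add: p_def poly_sum poly_monom)
    finally show ?thesis by (simp add: power_CARD_eq)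
  qed
  moreover have "degree p \<le> ?q - 1"
    unfolding p_def by (intro degree_sum_le) (auto intro: order.trans[OF degree_monom_le])
  ultimately have "p = 0" using q by (intro card_roots_eq_0) auto
  then have "coeff p i = 0" by simp
  moreover have "coeff p i = of_nat (?q choose i)"
    using assms by (simp add: p_def coeff_sum sum.delta)
  ultimately show ?thesis by simp
qed

section \<open>Frobenius and trace\<close>

locale cubic_extension =
  fixes emb :: "'a::{field,finite} \<Rightarrow> 'b::{field,finite}" and q :: nat
  assumes ext: "field_ext3 emb" and q_eq: "q = CARD('a)"
begin

lemma inj_emb: "inj emb"
  and emb_0 [simp]: "emb 0 = 0"
  and emb_1 [simp]: "emb 1 = 1"
  and emb_add: "emb (x + y) = emb x + emb y"
  and emb_mult: "emb (x * y) = emb x * emb y"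
  and CARD_ext: "CARD('b) = q ^ 3"
  using ext by (simp_all add: field_ext3_def q_eq)

lemma emb_eq_iff [simp]: "emb x = emb y \<longleftrightarrow> x = y"
  using inj_emb by (auto dest: injD)

lemma emb_eq_0_iff [simp]: "emb x = 0 \<longleftrightarrow> x = 0"
  using emb_eq_iff[of x 0] by simp

lemma emb_sum: "emb (sum f S) = (\<Sum>x\<in>S. emb (f x))"
  by (induction S rule: infinite_finite_induct) (simp_all add: emb_add)

lemma emb_power: "emb (x ^ n) = emb x ^ n"
  by (induction n) (simp_all add: emb_mult)

lemma emb_of_nat: "emb (of_nat n) = of_nat n"
  by (induction n) (simp_all add: emb_add)

lemma q_ge_2: "2 \<le> q" unfolding q_eq by (rule CARD_field_ge_2)

lemma q_pos [simp]: "0 < q" using q_ge_2 by simp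

lemma q_powers: "q < q ^ 2" "q ^ 2 < q ^ 3" "1 < q"
  using q_ge_2 by (simp_all add: power2_eq_square power3_eq_cube)

text \<open>The middle binomial coefficients vanish in the base field, whose cardinality is
  \<open>q\<close>, and \<open>emb\<close> carries this to the extension.\<close>

lemma frob_add: "(x + y :: 'b) ^ q = x ^ q + y ^ q"
proof -
  have split: "{..q} = insert 0 (insert q {1..<q})" using q_ge_2 by auto
  have "of_nat (q choose k) = (0 :: 'b)" if "k \<in> {1..<q}" for k
    using binomial_CARD_eq_0[of k, where 'a = 'a] that emb_of_nat[of "q choose k"] by (simp add: q_eq)
  then have "(\<Sum>k\<in>{1..<q}. of_nat (q choose k) * x ^ k * y ^ (q - k)) = 0"
    by (intro sum.neutral) simp
  then show ?thesis
    unfolding binomial_ring split using q_ge_2 by (simp add: add.commute)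
qed

lemma power_q3: "(x :: 'b) ^ (q ^ 3) = x"
  using power_CARD_eq[of x] by (simp add: CARD_ext)

lemma power_q2: "(x :: 'b) ^ (q ^ 2) = (x ^ q) ^ q"
  by (simp add: power2_eq_square power_mult)

lemma frob3: "(((x :: 'b) ^ q) ^ q) ^ q = x"
  using power_q3[of x] by (simp add: power3_eq_cube power_mult)

lemma frob_sum: "(sum f S :: 'b) ^ q = (\<Sum>x\<in>S. f x ^ q)"
  by (induction S rule: infinite_finite_induct) (simp_all add: frob_add power_0_left)

lemma frob_diff: "(x - y :: 'b) ^ q = x ^ q - y ^ q"
  using frob_add[of "x - y" y] by simp

lemma frob_emb: "emb x ^ q = emb x"
  by (simp add: q_eq power_CARD_eq flip: emb_power)

text \<open>X^q - X has at most \<open>q\<close> roots, and the \<open>q\<close> elements of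
  \<open>range emb\<close> are roots.\<close>

lemma frob_fixed: "(z :: 'b) ^ q = z \<Longrightarrow> z \<in> range emb"
proof -
  assume z: "z ^ q = z"
  define p :: "'b poly" where "p = monom 1 q + monom (-1) 1"
  have root: "poly p x = 0 \<longleftrightarrow> x ^ q = x" for x by (simp add: p_def poly_monom)
  have "coeff p q = 1" using q_ge_2 by (simp add: p_def)
  then have "p \<noteq> 0" by auto
  then have "card {x. poly p x = 0} \<le> degree p" by (rule card_poly_roots_bound)
  also have "\<dots> \<le> q" unfolding p_def using q_ge_2
    by (intro degree_add_le) (auto intro: order.trans[OF degree_monom_le])
  also have "\<dots> = card (range emb)" using inj_emb by (simp add: card_image q_eq)
  finally have "range emb = {x. poly p x = 0}"
    by (intro card_seteq) (auto simp: root frob_emb)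
  then show ?thesis using z root by blast
qed

definition Tr :: "'b \<Rightarrow> 'b" where "Tr z = z + z ^ q + (z ^ q) ^ q"

lemma Tr_add: "Tr (x + y) = Tr x + Tr y"
  by (simp add: Tr_def frob_add)

lemma Tr_diff: "Tr (x - y) = Tr x - Tr y"
  by (simp add: Tr_def frob_diff)

lemma Tr_0 [simp]: "Tr 0 = 0"
  using q_pos by (simp add: Tr_def power_0_left del: q_pos)

lemma Tr_sum: "Tr (sum f S) = (\<Sum>x\<in>S. Tr (f x))"
  by (induction S rule: infinite_finite_induct) (simp_all add: Tr_add)

lemma Tr_emb_mult: "Tr (emb c * z) = emb c * Tr z"
  by (simp add: Tr_def power_mult_distrib frob_emb algebra_simps)

lemma Tr_frob: "Tr (z ^ q) = Tr z"
  by (simp add: Tr_def frob3)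

text \<open>Computations use \<open>Tr\<close>, with values in the extension. As \<open>Tr z\<close>
  is fixed by Frobenius, \<open>inv emb\<close> brings it down to the base field.\<close>

definition tr :: "'b \<Rightarrow> 'a" where "tr z = inv emb (Tr z)"

lemma emb_tr: "emb (tr z) = Tr z"
proof -
  have "Tr z ^ q = Tr z" by (simp add: Tr_def frob_add frob3)
  then show ?thesis unfolding tr_def by (rule f_inv_into_f[OF frob_fixed])
qed

text \<open>The trace is a nonzero polynomial of degree at most q^2, too small to vanish on q^3
  elements.\<close>

lemma Tr_nonzero: "\<exists>z. Tr z \<noteq> 0"
proof (rule ccontr)
  assume "\<nexists>z. Tr z \<noteq> 0"
  define p :: "'b poly" where "p = monom 1 1 + monom 1 q + monom 1 (q ^ 2)"
  have "poly p x = Tr x" for x by (simp add: p_def poly_monom Tr_def power_q2)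
  with \<open>\<nexists>z. Tr z \<noteq> 0\<close> have "\<And>x. poly p x = 0" by simp
  moreover have "degree p < CARD('b)"
  proof -
    have "degree p \<le> q ^ 2" unfolding p_def using q_powers
      by (intro degree_add_le) (auto intro: order.trans[OF degree_monom_le])
    then show ?thesis unfolding CARD_ext using q_powers(2) by (rule le_less_trans)
  qed
  ultimately have "p = 0" by (rule card_roots_eq_0)
  moreover have "coeff p 1 = 1" using q_powers by (simp add: p_def)
  ultimately show False by simp
qed

lemma Tr_nondegenerate: "(\<And>z. Tr (z * c) = 0) \<Longrightarrow> c = 0"
proof (rule ccontr)
  assume *: "\<And>z. Tr (z * c) = 0" and "c \<noteq> 0"
  obtain z where "Tr z \<noteq> 0" using Tr_nonzero by blast
  with *[of "z / c"] \<open>c \<noteq> 0\<close> show False by simp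
qed

end

section \<open>Singer cycles\<close>

lemma mpow_add: "mpow A (i + j) = mpow A i ** mpow (A :: 'a::comm_ring_1 ^ 'n ^ 'n) j"
  by (induction i) (simp_all add: matrix_mul_assoc)

lemma cayley_hamilton_3:
  fixes A :: "'a::comm_ring_1 ^ 3 ^ 3"
  defines "m \<equiv> A $ 0 $ 0 * A $ 1 $ 1 - A $ 0 $ 1 * A $ 1 $ 0 + A $ 0 $ 0 * A $ 2 $ 2 - A $ 0 $ 2 * A $ 2 $ 0
    + A $ 1 $ 1 * A $ 2 $ 2 - A $ 1 $ 2 * A $ 2 $ 1"
  shows "A *v (A *v (A *v x)) =
    trace A *s (A *v (A *v x)) - m *s (A *v x) + det A *s x"
  by (simp add: vec3_eq_iff matrix_vector_mult_def sum_UNIV_3 trace_def det_UNIV_3 m_def algebra_simps)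

text \<open>X^k - 1 has fewer roots than there are nonzero elements. Substituting
  \<open>g * x\<close> for a nonzero non-root \<open>g\<close> multiplies the sum by
  \<open>g ^ k\<close>, which is not 1.\<close>

lemma sum_power_nonzero_eq_0:
  assumes "0 < k" "k < CARD('a) - 1"
  shows "(\<Sum>x\<in>UNIV - {0}. x ^ k) = (0 :: 'a::{field,finite})"
proof -
  define p :: "'a poly" where "p = monom 1 k - 1"
  have "coeff p k = 1" using assms by (simp add: p_def)
  then have "p \<noteq> 0" by auto
  then have "card {x. poly p x = 0} \<le> degree p" by (rule card_poly_roots_bound)
  also have "\<dots> \<le> k" unfolding p_def
    by (intro degree_diff_le) (auto intro: order.trans[OF degree_monom_le])
  also have "k < card (UNIV - {0 :: 'a})" using assms by (simp add: card_Diff_singleton)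
  finally have "\<not> UNIV - {0} \<subseteq> {x. poly p x = 0}"
    using card_mono[of "{x. poly p x = 0}" "UNIV - {0}"] by auto
  then obtain g where "g \<noteq> 0" "poly p g \<noteq> 0" by blast
  then have g: "g \<noteq> 0" "g ^ k \<noteq> 1" by (simp_all add: p_def poly_monom)
  let ?S = "\<Sum>x\<in>UNIV - {0 :: 'a}. x ^ k"
  have "g ^ k * ?S = (\<Sum>x\<in>UNIV - {0}. (g * x) ^ k)"
    by (simp add: sum_distrib_left power_mult_distrib)
  also have "\<dots> = ?S"
    by (rule sum.reindex_bij_witness[of _ "\<lambda>y. y / g" "\<lambda>y. g * y"]) (use g in auto)
  finally have "(g ^ k - 1) * ?S = 0" by (simp add: algebra_simps)
  then show ?thesis using g by simp
qed

locale singer = cubic_extension emb q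
  for emb :: "'a::{field,finite} \<Rightarrow> 'b::{field,finite}" and q +
  fixes s :: "'a ^ 3 ^ 3"
  assumes singer: "singer_cycle s"
begin

definition n :: nat where "n = q ^ 3 - 1"

lemma Suc_n: "Suc n = q ^ 3"
  using q_pos by (simp add: n_def del: q_pos)

lemma n_pos: "0 < n" and q_less_n: "q - 1 < n" "0 < q - 1"
  using Suc_n q_powers by linarith+

lemma mpow_n: "mpow s n = mat 1"
  and mpow_neq_1: "0 < k \<Longrightarrow> k < n \<Longrightarrow> mpow s k \<noteq> mat 1"
  using singer unfolding singer_cycle_def n_def q_eq[symmetric] by blast+

lemma mpow_inverse: "k \<le> n \<Longrightarrow> mpow s (n - k) ** mpow s k = mat 1"
  using mpow_n by (simp flip: mpow_add)

lemma mpow_vec_eq_0: "k \<le> n \<Longrightarrow> mpow s k *v x = 0 \<Longrightarrow> x = 0"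
  using mpow_inverse[of k] matrix_left_invertible_ker[of "mpow s k"] by blast

lemma inj_on_mpow: "inj_on (mpow s) {..<n}"
proof (rule linorder_inj_onI)
  fix i j assume ij: "i < j" "i \<in> {..<n}" "j \<in> {..<n}"
  show "mpow s i \<noteq> mpow s j"
  proof
    assume "mpow s i = mpow s j"
    then have "mpow s (n - j + i) = mpow s (n - j) ** mpow s j" by (simp only: mpow_add)
    then have "mpow s (n - j + i) = mat 1" using ij mpow_inverse[of j] by simp
    moreover have "0 < n - j + i" "n - j + i < n" using ij by auto
    ultimately show False using mpow_neq_1[of "n - j + i"] by metis
  qed
qed auto

text \<open>The algebra \<open>F[s]\<close>, of dimension 3 by Cayley--Hamilton.\<close>
definition alg :: "'a ^ 3 \<Rightarrow> 'a ^ 3 ^ 3" where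
  "alg v = (\<chi> i j. v $ 0 * (mat 1 :: 'a ^ 3 ^ 3) $ i $ j + v $ 1 * s $ i $ j + v $ 2 * (s ** s) $ i $ j)"

lemma alg_vec: "alg v *v x = v $ 0 *s x + v $ 1 *s (s *v x) + v $ 2 *s (s *v (s *v x))"
proof -
  have "alg v *v x = v $ 0 *s (mat 1 *v x) + v $ 1 *s (s *v x) + v $ 2 *s ((s ** s) *v x)"
    by (simp add: vec_eq_iff alg_def matrix_vector_mult_def sum.distrib sum_distrib_left algebra_simps
        del: matrix_vector_mul_lid)
  then show ?thesis by (simp add: matrix_vector_mul_assoc)
qed

lemma alg_diff: "alg (v - w) = alg v - alg w"
  by (simp add: vec_eq_iff alg_def algebra_simps)

lemma mpow_in_alg: "mpow s k \<in> range alg"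
proof (induction k)
  case 0
  have "mat 1 = alg (axis 0 1)" by (simp add: vec_eq_iff alg_def axis_def)
  then show ?case by simp
next
  case (Suc k)
  then obtain v where v: "mpow s k = alg v" by blast
  define m where "m = s $ 0 $ 0 * s $ 1 $ 1 - s $ 0 $ 1 * s $ 1 $ 0 + s $ 0 $ 0 * s $ 2 $ 2
    - s $ 0 $ 2 * s $ 2 $ 0 + s $ 1 $ 1 * s $ 2 $ 2 - s $ 1 $ 2 * s $ 2 $ 1"
  \<comment> \<open>Coefficients of \<open>s\<close> times \<open>alg v\<close>, with the cube of
    \<open>s\<close> reduced by Cayley-Hamilton.\<close>
  define w :: "'a ^ 3" where "w = (\<chi> i. if i = 0 then v $ 2 * det s
    else if i = 1 then v $ 0 - v $ 2 * m else v $ 1 + v $ 2 * trace s)"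
  have w [simp]: "w $ 0 = v $ 2 * det s" "w $ 1 = v $ 0 - v $ 2 * m" "w $ 2 = v $ 1 + v $ 2 * trace s"
    by (simp_all add: w_def)
  have "mpow s (Suc k) *v x = alg w *v x" for x
    by (simp add: v alg_vec matrix_vector_right_distrib vec.scale cayley_hamilton_3[of s, folded m_def]
        flip: matrix_vector_mul_assoc)
  then have "mpow s (Suc k) = alg w" by (simp add: matrix_eq)
  then show ?case by blast
qed

text \<open>The q^3 - 1 distinct powers of \<open>s\<close> together with 0 exhaust the at most q^3
  elements of the algebra, so every nonzero element is invertible.\<close>

lemma bij_alg: "inj alg" "range alg = insert 0 (mpow s ` {..<n})"
proof -
  let ?P = "insert 0 (mpow s ` {..<n})"
  have "alg 0 = 0" by (simp add: vec_eq_iff alg_def)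
  then have sub: "?P \<subseteq> range alg" using mpow_in_alg by (auto intro: range_eqI[of _ _ 0])
  have "0 \<notin> mpow s ` {..<n}"
  proof
    assume "0 \<in> mpow s ` {..<n}"
    then obtain k where "k < n" "mpow s k = 0" by (metis imageE lessThan_iff)
    then have "axis 0 1 = (0 :: 'a ^ 3)" using mpow_vec_eq_0[of k "axis 0 1"] by simp
    then show False by (simp add: axis_eq_0_iff)
  qed
  then have cP: "card ?P = q ^ 3" by (simp add: card_image inj_on_mpow Suc_n)
  have cV: "CARD('a ^ 3) = q ^ 3" by (simp add: q_eq)
  have "card (range alg) \<le> q ^ 3" using card_image_le[of UNIV alg] cV by simp
  then show r: "range alg = ?P" using sub cP by (metis card_seteq finite)
  show "inj alg" by (rule eq_card_imp_inj_on) (simp_all only: r cP cV finite)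
qed

text \<open>Nonzero elements of the algebra are powers of \<open>s\<close> and kill no nonzero
  vector. Evaluation at \<open>x\<close> is thus injective, and onto by counting.\<close>

lemma alg_vec_surj:
  assumes "x \<noteq> 0"
  shows "\<exists>v. y = alg v *v x"
proof -
  have "inj (\<lambda>v. alg v *v x)"
  proof (rule injI)
    fix v w assume "alg v *v x = alg w *v x"
    then have "alg (v - w) *v x = 0" by (simp add: alg_diff matrix_vector_mult_diff_rdistrib)
    then have "alg (v - w) \<noteq> mpow s k" if "k < n" for k
      using mpow_vec_eq_0[of k x] assms that by auto
    moreover have "alg (v - w) \<in> insert 0 (mpow s ` {..<n})" using bij_alg(2) by blast
    ultimately have "alg (v - w) = 0" by blast
    then show "v = w" using bij_alg(1) by (simp add: alg_diff injD)
  qed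
  then have "card (range (\<lambda>v. alg v *v x)) = CARD('a ^ 3)" by (rule card_image)
  then have "range (\<lambda>v. alg v *v x) = UNIV" by (intro card_subset_eq finite subset_UNIV)
  then show ?thesis by blast
qed

text \<open>An eigenfunctional of \<open>s\<close> over the extension is a component of the discrete Fourier
  transform of an arbitrary nonzero functional along the powers of \<open>s\<close>.\<close>
lemma eigenfunctional:
  obtains \<phi> :: "'a ^ 3 \<Rightarrow> 'b" and l where
    "\<And>x y. \<phi> (x + y) = \<phi> x + \<phi> y" "\<And>c x. \<phi> (c *s x) = emb c * \<phi> x"
    "\<And>x. \<phi> (s *v x) = l * \<phi> x" "\<exists>x. \<phi> x \<noteq> 0"
proof -
  define f where "f l x k = inverse l ^ k * emb ((mpow s k *v x) $ 0)" for l :: 'b and x k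
  define F where "F l x = (\<Sum>k<n. f l x k)" for l x
  have eig: "F l (s *v x) = l * F l x" if "l \<noteq> 0" for l x
  proof -
    \<comment> \<open>Since \<open>l ^ n = 1\<close>, the summands have period \<open>n\<close>, and
      shifting the index by one produces the factor \<open>l\<close>.\<close>
    have "l * l ^ n = l" using power_q3[of l] by (simp flip: Suc_n)
    then have "l ^ n = 1" using that by simp
    then have per: "f l x n = f l x 0" by (simp add: f_def mpow_n power_inverse)
    have comm: "mpow s k *v (s *v x) = mpow s (Suc k) *v x" for k
      using mpow_add[of s k 1] by (simp add: matrix_vector_mul_assoc)
    have "f l x 0 + (\<Sum>k<n. f l x (Suc k)) = sum (f l x) {..<Suc n}"
      by (rule sum.lessThan_Suc_shift[symmetric])
    also have "\<dots> = f l x 0 + F l x"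
      by (simp only: sum.lessThan_Suc F_def per add.commute)
    finally have "(\<Sum>k<n. f l x (Suc k)) = F l x" by (rule add_left_imp_eq)
    moreover have "F l (s *v x) = l * (\<Sum>k<n. f l x (Suc k))"
      using that by (simp add: F_def f_def comm sum_distrib_left field_simps del: mpow.simps)
    ultimately show ?thesis by simp
  qed
  \<comment> \<open>Fourier inversion at index 0: summing over \<open>l\<close> kills every term
    with \<open>k\<close> nonzero, so the components cannot all vanish.\<close>
  have inv: "(\<Sum>l\<in>UNIV - {0}. F l x) = - emb (x $ 0)" for x
  proof -
    have z: "(\<Sum>l\<in>UNIV - {0}. inverse l ^ k) = (0 :: 'b)" if "0 < k" "k < n" for k
    proof -
      have "(\<Sum>l\<in>UNIV - {0}. inverse l ^ k) = (\<Sum>l\<in>UNIV - {0 :: 'b}. l ^ k)"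
        by (rule sum.reindex_bij_witness[of _ inverse inverse]) auto
      also have "\<dots> = 0" using that by (intro sum_power_nonzero_eq_0) (simp_all add: CARD_ext n_def)
      finally show ?thesis .
    qed
    have "(\<Sum>l\<in>UNIV - {0}. F l x) =
      (\<Sum>k<n. (\<Sum>l\<in>UNIV - {0}. inverse l ^ k) * emb ((mpow s k *v x) $ 0))"
      unfolding F_def f_def by (subst sum.swap) (simp add: sum_distrib_right)
    also have "\<dots> = (\<Sum>k\<in>{0}. (\<Sum>l\<in>UNIV - {0}. inverse l ^ k) * emb ((mpow s k *v x) $ 0))"
      using n_pos z by (intro sum.mono_neutral_right) auto
    also have "\<dots> = of_nat n * emb (x $ 0)" by (simp add: card_Diff_singleton CARD_ext n_def)
    \<comment> \<open>\<open>n + 1\<close> is q^3, and \<open>q\<close> vanishes in the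
      field.\<close>
    also have "of_nat n = (- 1 :: 'b)"
    proof -
      have "(of_nat q :: 'a) = 0"
        using binomial_CARD_eq_0[of 1, where 'a = 'a] q_powers by (simp add: q_eq)
      then have "(of_nat q :: 'b) = 0" using emb_of_nat[of q] by simp
      then have "(of_nat (Suc n) :: 'b) = 0" unfolding Suc_n by simp
      then show ?thesis by (simp add: eq_neg_iff_add_eq_0 add.commute)
    qed
    finally show ?thesis by simp
  qed
  have "\<exists>l\<in>UNIV - {0}. \<exists>x. F l x \<noteq> 0"
  proof (rule ccontr)
    assume "\<not> ?thesis"
    then have "(\<Sum>l\<in>UNIV - {0}. F l (axis 0 1)) = 0" by (intro sum.neutral) auto
    then show False unfolding inv by simp
  qed
  then obtain l where l: "l \<noteq> 0" "\<exists>x. F l x \<noteq> 0" by blast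
  show ?thesis
  proof (rule that[of "F l" l])
    show "F l (x + y) = F l x + F l y" for x y
      by (simp add: F_def f_def matrix_vector_right_distrib emb_add sum.distrib algebra_simps)
    show "F l (c *s x) = emb c * F l x" for c x
      by (simp add: F_def f_def vec.scale emb_mult sum_distrib_left mult_ac)
  qed (use eig l in auto)
qed

lemma field_coordinate:
  obtains \<phi> :: "'a ^ 3 \<Rightarrow> 'b" and l where
    "\<And>x y. \<phi> (x + y) = \<phi> x + \<phi> y" "\<And>c x. \<phi> (c *s x) = emb c * \<phi> x"
    "\<And>x. \<phi> (s *v x) = l * \<phi> x" "bij \<phi>" "l ^ q \<noteq> l"
proof (rule eigenfunctional)
  fix \<phi> :: "'a ^ 3 \<Rightarrow> 'b" and l
  assume add: "\<And>x y. \<phi> (x + y) = \<phi> x + \<phi> y" and scale: "\<And>c x. \<phi> (c *s x) = emb c * \<phi> x"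
    and eig: "\<And>x. \<phi> (s *v x) = l * \<phi> x" and nz: "\<exists>x. \<phi> x \<noteq> 0"
  \<comment> \<open>The kernel is invariant under \<open>s\<close>, and the algebra carries any
    nonzero vector to every vector.\<close>
  have ker: "x = 0" if "\<phi> x = 0" for x
  proof (rule ccontr)
    assume "x \<noteq> 0"
    have "\<phi> (alg v *v x) = 0" for v by (simp add: alg_vec add scale eig that)
    then show False using nz alg_vec_surj[OF \<open>x \<noteq> 0\<close>] by metis
  qed
  have inj: "inj \<phi>"
  proof (rule injI)
    fix x y assume "\<phi> x = \<phi> y"
    then have "\<phi> (x + (- 1) *s y) = \<phi> y + \<phi> ((- 1) *s y)" by (simp only: add)
    also have "\<dots> = \<phi> 0" by (simp flip: add)
    also have "\<dots> = 0" using scale[of 0 0] by simp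
    finally have "x + (- 1) *s y = 0" by (rule ker)
    then show "x = y" by simp
  qed
  have "card (range \<phi>) = CARD('b)"
    using inj by (simp add: card_image CARD_ext q_eq)
  then have "surj \<phi>" using card_seteq[of UNIV "range \<phi>"] by simp
  have mp: "\<phi> (mpow s k *v x) = l ^ k * \<phi> x" for k x
    by (induction k) (simp_all add: eig mult_ac flip: matrix_vector_mul_assoc)
  have "l \<noteq> 0"
  proof
    assume "l = 0"
    then have "\<phi> (mpow s n *v x) = 0" for x using n_pos by (simp add: mp)
    then show False using nz by (simp add: mpow_n)
  qed
  \<comment> \<open>Otherwise \<open>l\<close> has order dividing \<open>q - 1\<close>, and by
    injectivity so has \<open>s\<close>, whose order is \<open>n\<close>.\<close>
  have "l ^ q \<noteq> l"
  proof
    assume "l ^ q = l"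
    then have "l * l ^ (q - 1) = l * 1" using q_pos by (simp flip: power_Suc del: q_pos)
    then have "l ^ (q - 1) = 1" using \<open>l \<noteq> 0\<close> by simp
    then have "mpow s (q - 1) *v x = x" for x using injD[OF inj] mp by simp
    then have "mpow s (q - 1) = mat 1" by (simp add: matrix_eq)
    then show False using mpow_neq_1 q_less_n by blast
  qed
  then show ?thesis using that[of \<phi> l] add scale eig bijI[OF inj \<open>surj \<phi>\<close>] by blast
qed

end

section \<open>The partial spreads\<close>

locale singer_coordinate = singer emb q s
  for emb :: "'a::{field,finite} \<Rightarrow> 'b::{field,finite}" and q s +
  fixes \<phi> :: "'a ^ 3 \<Rightarrow> 'b" and l
  assumes phi_add: "\<phi> (x + y) = \<phi> x + \<phi> y" and phi_smult: "\<phi> (c *s x) = emb c * \<phi> x"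
    and phi_eigen: "\<phi> (s *v x) = l * \<phi> x" and bij_phi: "bij \<phi>" and l_frob: "l ^ q \<noteq> l"
begin

lemma phi_0 [simp]: "\<phi> 0 = 0"
  using phi_smult[of 0 0] by simp

lemma phi_eq_0_iff [simp]: "\<phi> x = 0 \<longleftrightarrow> x = 0"
  using bij_phi phi_0 by (metis bij_pointE)

lemma phi_surj: "\<exists>x. \<phi> x = z"
  using bij_phi by (metis bij_pointE)

definition u :: "3 \<Rightarrow> 'b" where "u i = \<phi> (axis i 1)"

lemma phi_sum: "\<phi> (sum f S) = (\<Sum>i\<in>S. \<phi> (f i))"
  by (induction S rule: infinite_finite_induct) (simp_all add: phi_add)

lemma phi_expand: "\<phi> x = (\<Sum>i\<in>UNIV. u i * emb (x $ i))"
proof -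
  have "\<phi> x = \<phi> (\<Sum>i\<in>UNIV. (x $ i) *s axis i 1)" by (simp only: basis_expansion)
  also have "\<dots> = (\<Sum>i\<in>UNIV. u i * emb (x $ i))"
    by (simp only: phi_sum phi_smult u_def mult.commute)
  finally show ?thesis .
qed

section \<open>The forms of the circumscribed bundle\<close>

definition A :: "'b \<Rightarrow> 'a ^ 3 ^ 3" where "A b = (\<chi> i j. tr (b * u i * u j ^ q))"

lemma A_vec: "emb ((A b *v y) $ i) = Tr (b * u i * \<phi> y ^ q)"
proof -
  have "emb ((A b *v y) $ i) = (\<Sum>j\<in>UNIV. Tr (b * u i * u j ^ q) * emb (y $ j))"
    by (simp add: matrix_vector_mult_def A_def emb_sum emb_mult emb_tr)
  also have "\<dots> = Tr (\<Sum>j\<in>UNIV. emb (y $ j) * (b * u i * u j ^ q))"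
    by (simp only: Tr_sum Tr_emb_mult mult.commute)
  also have "(\<Sum>j\<in>UNIV. emb (y $ j) * (b * u i * u j ^ q)) = b * u i * \<phi> y ^ q"
    by (simp add: phi_expand frob_sum power_mult_distrib frob_emb sum_distrib_left mult_ac)
  finally show ?thesis .
qed

lemma A_bilinear: "emb (dot x (A b *v y)) = Tr (b * \<phi> x * \<phi> y ^ q)"
proof -
  have "emb (dot x (A b *v y)) = (\<Sum>i\<in>UNIV. emb (x $ i) * Tr (b * u i * \<phi> y ^ q))"
    by (simp add: dot_def emb_sum emb_mult A_vec)
  also have "\<dots> = Tr (\<Sum>i\<in>UNIV. emb (x $ i) * (b * u i * \<phi> y ^ q))"
    by (simp only: Tr_sum Tr_emb_mult)
  also have "(\<Sum>i\<in>UNIV. emb (x $ i) * (b * u i * \<phi> y ^ q)) = b * \<phi> x * \<phi> y ^ q"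
    by (simp add: phi_expand[of x] sum_distrib_left sum_distrib_right mult_ac)
  finally show ?thesis .
qed

lemma qform_A: "emb (qform (A b) x) = Tr (b * \<phi> x * \<phi> x ^ q)"
  by (simp add: qform_dot A_bilinear)

lemma A_diff: "A (b - c) = A b - A c"
proof -
  have "emb (x - y) = emb x - emb y" for x y
    using emb_add[of "x - y" y] by (simp add: algebra_simps)
  then have "emb (tr (z - w)) = emb (tr z - tr w)" for z w
    by (simp add: emb_tr Tr_diff)
  then show ?thesis by (simp add: vec_eq_iff A_def left_diff_distrib)
qed

lemma A_kernel:
  assumes "A b *v y = 0" "b \<noteq> 0"
  shows "y = 0"
proof -
  have "Tr (z * (b * \<phi> y ^ q)) = 0" for z
  proof -
    obtain x where "\<phi> x = z" using phi_surj by blast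
    then show ?thesis using A_bilinear[of x b y] assms(1) by (simp add: mult_ac)
  qed
  then have "b * \<phi> y ^ q = 0" by (rule Tr_nondegenerate)
  then show ?thesis using assms(2) by simp
qed

lemma polar_A: "emb (dot (polar (A b) x) y) = Tr (\<phi> y * (b * \<phi> x ^ q + ((b * \<phi> x) ^ q) ^ q))"
proof -
  have "dot (polar (A b) x) y = dot x (A b *v y) + dot y (A b *v x)"
    by (simp only: dot_transpose[of x] polar_def dot_add_left) (simp add: dot_commute)
  then have "emb (dot (polar (A b) x) y) = Tr (b * \<phi> x * \<phi> y ^ q) + Tr (b * \<phi> y * \<phi> x ^ q)"
    by (simp add: emb_add A_bilinear)
  \<comment> \<open>Applying Frobenius twice preserves the trace and turns the conjugate of
    \<open>\<phi> y\<close> back into \<open>\<phi> y\<close>.\<close>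
  also have "Tr (b * \<phi> x * \<phi> y ^ q) = Tr (((b * \<phi> x) ^ q) ^ q * \<phi> y)"
    using Tr_frob[of "(b * \<phi> x * \<phi> y ^ q) ^ q"] Tr_frob[of "b * \<phi> x * \<phi> y ^ q"]
    by (simp add: power_mult_distrib frob3)
  finally show ?thesis by (simp add: algebra_simps flip: Tr_add)
qed

text \<open>If \<open>x\<close> is in the polar radical, two of the three terms of \<open>Tr (b x\<^sup>q\<^sup>+\<^sup>1)\<close> cancel and the third is a
  nonzero monomial; this argument does not depend on the characteristic.\<close>
lemma nondeg_A:
  assumes "b \<noteq> 0"
  shows "nondeg (A b)"
  unfolding nondeg_iff
proof (intro allI impI)
  fix x assume x: "qform (A b) x = 0 \<and> polar (A b) x = 0"
  define c where "c = b * \<phi> x ^ q + ((b * \<phi> x) ^ q) ^ q"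
  have "Tr (z * c) = 0" for z
  proof -
    obtain y where "\<phi> y = z" using phi_surj by blast
    then show ?thesis using polar_A[of b x y] x by (simp add: c_def)
  qed
  then have "c = 0" by (rule Tr_nondegenerate)
  have "0 = Tr (b * \<phi> x * \<phi> x ^ q)" using qform_A[of b x] x by simp
  also have "\<dots> = \<phi> x * c + (b * \<phi> x * \<phi> x ^ q) ^ q"
    by (simp add: Tr_def c_def power_mult_distrib frob3 algebra_simps)
  finally show "x = 0" using assms \<open>c = 0\<close> by simp
qed

text \<open>Up to the norm of \<open>X\<close>, \<open>Tr (b X\<^sup>q\<^sup>+\<^sup>1)\<close> is the trace of \<open>b\<close> divided by a conjugate of \<open>X\<close>; it vanishes
  if that quotient is \<open>l\<^sup>q - l\<close>.\<close>
lemma isotropic_A: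
  assumes "b \<noteq> 0"
  shows "\<exists>x. x \<noteq> 0 \<and> qform (A b) x = 0"
proof -
  define z where "z = l ^ q - l"
  have z: "z \<noteq> 0" "Tr z = 0" using l_frob by (simp_all add: z_def Tr_diff Tr_frob)
  \<comment> \<open>The exponent is chosen so that two further Frobenius steps give
    \<open>b / z\<close>.\<close>
  obtain x where x: "\<phi> x = (b / z) ^ q" using phi_surj by blast
  define N where "N = \<phi> x * \<phi> x ^ q * (\<phi> x ^ q) ^ q"
  have "N ^ q = N" by (simp add: N_def power_mult_distrib frob3)
  then obtain c where c: "N = emb c" using frob_fixed by blast
  have "b = z * (\<phi> x ^ q) ^ q" using z by (simp add: x frob3)
  then have "b * \<phi> x * \<phi> x ^ q = emb c * z" by (simp add: N_def flip: c)
  then have "emb (qform (A b) x) = 0" by (simp add: qform_A Tr_emb_mult z)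
  moreover have "x \<noteq> 0" using x z assms by auto
  ultimately show ?thesis by auto
qed

lemma l_conjugates: "l \<noteq> l ^ q" "l ^ q \<noteq> (l ^ q) ^ q" "l \<noteq> (l ^ q) ^ q"
  using l_frob frob3[of l] by metis+

text \<open>A delta vertex is orthogonal to at least two of the three eigenfunctionals \<open>u\<close>, \<open>u\<^sup>q\<close>, \<open>u\<^sup>q\<^sup>2\<close> of
  \<open>s\<close>, since these have different eigenvalues.\<close>
lemma qform_A_delta:
  assumes "v \<in> delta_vertices emb s"
  shows "qform (mapm emb (A b)) v = 0"
proof -
  obtain m where m: "mapm emb s *v v = m *s v" using assms by (auto simp: delta_vertices_def)
  define U where "U f = (\<Sum>i\<in>UNIV. f (u i) * v $ i)" for f :: "'b \<Rightarrow> 'b"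
  \<comment> \<open>\<open>f\<close> stands for a power of Frobenius. Applied to the eigenvalue
    equation of \<open>u\<close>, it shows that the conjugate functional has eigenvalue
    \<open>f l\<close>.\<close>
  have eig: "(f l - m) * U f = 0"
    if f: "\<And>x y. f (x * y) = f x * f y" "\<And>g :: 3 \<Rightarrow> 'b. f (\<Sum>i\<in>UNIV. g i) = (\<Sum>i\<in>UNIV. f (g i))"
      "\<And>c. f (emb c) = emb c" for f
  proof -
    have u: "l * u i = (\<Sum>j\<in>UNIV. u j * emb (s $ j $ i))" for i
    proof -
      have "(s *v axis i 1) $ j = s $ j $ i" for j
        by (simp add: matrix_vector_mult_def axis_def if_distrib sum.delta cong: if_cong)
      then show ?thesis using phi_eigen[of "axis i 1"] phi_expand[of "s *v axis i 1"]
        by (simp add: u_def)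
    qed
    have "f l * U f = (\<Sum>i\<in>UNIV. f (l * u i) * v $ i)"
      by (simp add: U_def f sum_distrib_left mult_ac)
    also have "\<dots> = (\<Sum>i\<in>UNIV. \<Sum>j\<in>UNIV. f (u j) * (emb (s $ j $ i) * v $ i))"
      by (simp only: u f) (simp add: sum_distrib_left mult_ac)
    also have "\<dots> = (\<Sum>j\<in>UNIV. f (u j) * (mapm emb s *v v) $ j)"
      by (subst sum.swap) (simp add: mapm_def matrix_vector_mult_def sum_distrib_left)
    also have "\<dots> = m * U f" by (simp add: m U_def sum_distrib_left mult_ac)
    finally show ?thesis by (simp add: algebra_simps)
  qed
  let ?U0 = "U (\<lambda>x. x)" and ?U1 = "U (\<lambda>x. x ^ q)" and ?U2 = "U (\<lambda>x. (x ^ q) ^ q)"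
  have "(l - m) * ?U0 = 0" "(l ^ q - m) * ?U1 = 0" "((l ^ q) ^ q - m) * ?U2 = 0"
    using eig[of "\<lambda>x. x"] eig[of "\<lambda>x. x ^ q"] eig[of "\<lambda>x. (x ^ q) ^ q"]
    by (simp_all add: power_mult_distrib frob_sum frob_emb)
  \<comment> \<open>The three conjugates of \<open>l\<close> are distinct, so \<open>m\<close>
    equals at most one of them and at most one \<open>U\<close> is nonzero.\<close>
  then have zero: "?U0 * ?U1 = 0" "?U1 * ?U2 = 0" "?U0 * ?U2 = 0"
    using l_conjugates by auto
  have prod: "(\<Sum>i\<in>UNIV. \<Sum>j\<in>UNIV. c * f (u i) * g (u j) * v $ i * v $ j) = c * (U f * U g)" for c f g
    unfolding U_def sum_product by (simp add: sum_distrib_left mult_ac)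
  have "qform (mapm emb (A b)) v =
    (\<Sum>i\<in>UNIV. \<Sum>j\<in>UNIV. Tr (b * u i * u j ^ q) * v $ i * v $ j)"
    by (simp add: qform_def mapm_def A_def emb_tr)
  also have "\<dots> =
    (\<Sum>i\<in>UNIV. \<Sum>j\<in>UNIV. b * u i * u j ^ q * v $ i * v $ j) +
    (\<Sum>i\<in>UNIV. \<Sum>j\<in>UNIV. b ^ q * u i ^ q * (u j ^ q) ^ q * v $ i * v $ j) +
    (\<Sum>i\<in>UNIV. \<Sum>j\<in>UNIV. (b ^ q) ^ q * (u i ^ q) ^ q * u j * v $ i * v $ j)"
    by (simp add: Tr_def power_mult_distrib frob3 distrib_right sum.distrib)
  also have "\<dots> = b * (?U0 * ?U1) + b ^ q * (?U1 * ?U2) + (b ^ q) ^ q * (?U2 * ?U0)"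
    by (simp only: prod[of _ "\<lambda>x. x" "\<lambda>x. x ^ q"] prod[of _ "\<lambda>x. x ^ q" "\<lambda>x. (x ^ q) ^ q"]
        prod[of _ "\<lambda>x. (x ^ q) ^ q" "\<lambda>x. x"])
  finally show ?thesis using zero by (simp add: mult.commute[of ?U2])
qed

section \<open>Disjointness and counting of the planes\<close>

definition plane :: "'a ^ 3 \<Rightarrow> 'b \<Rightarrow> ('a ^ 6) set" where
  "plane t b = range (gvec (A b + crossm t))"

lemma plane_in_S1:
  assumes "b \<noteq> 0"
  shows "plane t b \<in> S1 emb s"
proof -
  have "emb (- x) = - emb x" for x
    using emb_add[of x "- x"] by (simp add: eq_neg_iff_add_eq_0 add.commute)
  then have "mapm emb (A b + crossm t) = mapm emb (A b) + crossm (mapv emb t)"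
    by (simp add: vec3_eq_iff mapm_def mapv_def emb_add crossm_nth)
  then have "A b + crossm t \<in> circ_bundle emb s"
    using assms by (simp add: circ_bundle_def nondeg_A qform_A_delta)
  moreover obtain x where "x \<noteq> 0" "qform (A b + crossm t) x = 0"
    using isotropic_A[OF assms] by auto
  ultimately show ?thesis unfolding plane_def by (rule graph_in_S1)
qed

lemma plane_Int:
  assumes "b \<noteq> c"
  shows "plane t b \<inter> plane t c = {0}"
proof -
  have "gvec (A b + crossm t) x = 0"
    if "gvec (A b + crossm t) x = gvec (A c + crossm t) y" for x y
  proof -
    have "A b *v x = A c *v x"
      using that by (auto simp: gvec_eq_iff matrix_vector_mult_add_rdistrib)
    then have "A (b - c) *v x = 0" by (simp add: A_diff matrix_vector_mult_diff_rdistrib)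
    then have "x = 0" using A_kernel assms by simp
    then show ?thesis by (simp add: gvec_eq_0_iff)
  qed
  moreover have "0 \<in> plane t b" "0 \<in> plane t c"
    unfolding plane_def using gvec_eq_0_iff by (metis rangeI)+
  ultimately show ?thesis by (auto simp: plane_def)
qed

lemma plane_eq_iff: "plane t b = plane t' c \<longleftrightarrow> t = t' \<and> b = c"
proof
  assume eq: "plane t b = plane t' c"
  have "(A b + crossm t) *v x = (A c + crossm t') *v x" for x
  proof -
    have "gvec (A b + crossm t) x \<in> plane t' c" using eq by (auto simp: plane_def)
    then show ?thesis by (auto simp: plane_def gvec_eq_iff)
  qed
  then have M: "A b + crossm t = A c + crossm t'" by (simp add: matrix_eq)
  have bc: "b = c"
  proof (rule ccontr)
    assume "b \<noteq> c"
    \<comment> \<open>The difference would be alternating, so its form would vanish identically,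
      contradicting nondegeneracy.\<close>
    have "A (b - c) = 0 + crossm (t' + (- 1) *s t)"
      using M by (simp add: A_diff vec3_eq_iff crossm_nth algebra_simps)
    then have "qform (A (b - c)) x = 0" for x by (simp only: qform_crossm) (simp add: qform_dot)
    moreover from this have "polar (A (b - c)) x = 0" for x
      using qform_add[of "A (b - c)" x] by (simp flip: dot_all_zero)
    moreover have "nondeg (A (b - c))" using \<open>b \<noteq> c\<close> by (intro nondeg_A) simp
    ultimately have "axis 0 1 = (0 :: 'a ^ 3)" unfolding nondeg_iff by blast
    then show False by (simp add: axis_eq_0_iff)
  qed
  then show "t = t' \<and> b = c" using M by (simp add: crossm_eq_iff)
qed simp

lemma partial_spreads:
  "\<exists>\<T>. card \<T> = q^3 - q^2 - q \<and>
    (\<forall>T\<in>\<T>. T \<subseteq> S1 emb s \<and> card T = q^3 - 1 \<and>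
      (\<forall>X\<in>T. \<forall>Y\<in>T. X \<noteq> Y \<longrightarrow> X \<inter> Y = {0}))"
proof -
  let ?T = "\<lambda>t. plane t ` (UNIV - {0})"
  have "inj ?T"
  proof (rule injI)
    fix t t' assume eq: "?T t = ?T t'"
    have "plane t 1 \<in> ?T t" by simp
    then have "plane t 1 \<in> ?T t'" by (simp only: eq)
    then show "t = t'" by (auto simp: plane_eq_iff)
  qed
  \<comment> \<open>Each of the q^3 vectors \<open>t\<close> gives its own set of planes; as many as
    the claim asks for are selected.\<close>
  obtain D :: "('a ^ 3) set" where "card D = q^3 - q^2 - q"
    using obtain_subset_with_card_n[of "q^3 - q^2 - q" "UNIV :: ('a ^ 3) set"] by (auto simp: q_eq)
  then have "card (?T ` D) = q^3 - q^2 - q"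
    using \<open>inj ?T\<close> by (simp add: card_image inj_on_subset)
  moreover have "card (?T t) = q^3 - 1" for t
  proof -
    have "inj_on (plane t) (UNIV - {0})" by (auto simp: inj_on_def plane_eq_iff)
    then show ?thesis by (simp add: card_image card_Diff_singleton CARD_ext)
  qed
  moreover have "?T t \<subseteq> S1 emb s" for t by (auto intro: plane_in_S1)
  moreover have "X \<inter> Y = {0}" if XY: "X \<in> ?T t" "Y \<in> ?T t" "X \<noteq> Y" for t X Y
  proof -
    obtain b c where "X = plane t b" "Y = plane t c" using XY by blast
    then show ?thesis using plane_Int[of b c t] XY by blast
  qed
  ultimately show ?thesis by (intro exI[of _ "?T ` D"]) blast
qed

end

theorem theorem3p12:
  fixes s :: "'a::{field,finite} ^ 3 ^ 3"
    and emb :: "'a \<Rightarrow> 'b::{field,finite}"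
  assumes "singer_cycle s"
    and "field_ext3 emb"
  defines "q \<equiv> CARD('a)"
  shows "\<exists>\<T>. card \<T> = q^3 - q^2 - q \<and>
            (\<forall>T\<in>\<T>. T \<subseteq> S1 emb s \<and> card T = q^3 - 1 \<and>
                     (\<forall>X\<in>T. \<forall>Y\<in>T. X \<noteq> Y \<longrightarrow> X \<inter> Y = {0}))"
proof -
  interpret singer emb q s
    using assms by unfold_locales auto
  show ?thesis
  proof (rule field_coordinate)
    fix \<phi> :: "'a ^ 3 \<Rightarrow> 'b" and l
    assume "\<And>x y. \<phi> (x + y) = \<phi> x + \<phi> y" "\<And>c x. \<phi> (c *s x) = emb c * \<phi> x"
      "\<And>x. \<phi> (s *v x) = l * \<phi> x" "bij \<phi>" "l ^ q \<noteq> l"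
    then interpret singer_coordinate emb q s \<phi> l by unfold_locales
    show ?thesis by (rule partial_spreads)
  qed
qed

end
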